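(* Let $0<m\le M$ and let $f:\mathbb{R}^p\to\mathbb{R}$ be twice differentiable with Hessian satisfying $m\mathbf{I}_p\preceq\nabla^2 f(x)\preceq M\mathbf{I}_p$ for every $x\in\mathbb{R}^p$. Let $\mu_1,\mu_2,\mu_2'$ be three probability measures on $\mathbb{R}^p$ and define the product measures $\mu=\mu_1\otimes\mu_2$ and $\mu'=\mu_1\otimes\mu_2'$ on $\mathbb{R}^p\times\mathbb{R}^p$ (first factor: velocity; second factor: position). For every friction coefficient $\gamma>0$ and every $t>0$, there exist numbers $\alpha\le\sqrt{2}$ and $\beta\ge\{m\wedge(\gamma^2-M)\}/\gamma$ such that $$W_2(\mu\mathbf{P}_t^{L},\mu'\mathbf{P}_t^{L})\le\alpha e^{-\beta t}\,W_2(\mu,\mu').$$ More precisely, for every $v\in[0,\gamma/2)$, $$W_2(\mu\mathbf{P}_t^{L},\mu'\mathbf{P}_t^{L})\le\frac{\sqrt{2((\gamma-v)^2+v^2)}}{\gamma-2v}\exp\bigg\{\frac{(v^2-m)\vee(M-(\gamma-v)^2)}{\gamma-2v}\,t\bigg\}W_2(\mu,\mu').$$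
   Context: The kinetic Langevin diffusion with friction coefficient $\gamma>0$ (and inverse mass $u=1$) is the strong solution $(V_t,L_t)_{t\ge0}$, with values in $\mathbb{R}^p\times\mathbb{R}^p$, of $$dV_t=-(\gamma V_t+\nabla f(L_t))\,dt+\sqrt{2\gamma}\,dW_t,\qquad dL_t=V_t\,dt,\qquad t\ge 0,$$ where $W$ is a standard $p$-dimensional Brownian motion independent of the initial condition $(V_0,L_0)$. For a probability measure $\mu$ on $\mathbb{R}^p\times\mathbb{R}^p$, $\mu\mathbf{P}_t^{L}$ denotes the distribution of the position component $L_t$ when $(V_0,L_0)\sim\mu$. $W_2$ is the Wasserstein-Kantorovich distance of order 2 with respect to the Euclidean norm. Notation: $a\wedge b=\min(a,b)$, $a\vee b=\max(a,b)$. *)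

theory Defs
  imports "HOL-Probability.Probability"
begin

section \<open>Gradient, Hessian and the Loewner order\<close>

text \<open>Both operators are meaningful only where the derivatives exist; twice differentiability has to
  be assumed separately.\<close>

definition grad :: "('a::real_inner \<Rightarrow> real) \<Rightarrow> 'a \<Rightarrow> 'a" where
  "grad f x = (THE D. GDERIV f x :> D)"

definition hessian :: "(real^'p \<Rightarrow> real) \<Rightarrow> real^'p \<Rightarrow> real^'p^'p" where
  "hessian f x = jacobian (grad f) (at x)"

definition loewner_le :: "real^'p^'p \<Rightarrow> real^'p^'p \<Rightarrow> bool" where
  "loewner_le A B \<longleftrightarrow> transpose (B - A) = B - A \<and> (\<forall>x. 0 \<le> x \<bullet> ((B - A) *v x))"


section \<open>The Wasserstein distance of order 2\<close>

definition couplings :: "'a measure \<Rightarrow> 'b measure \<Rightarrow> ('a \<times> 'b) measure set" where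
  "couplings \<mu> \<nu> = {\<pi>. sets \<pi> = sets (\<mu> \<Otimes>\<^sub>M \<nu>) \<and> distr \<pi> \<mu> fst = \<mu> \<and> distr \<pi> \<nu> snd = \<nu>}"

definition ennreal_sqrt :: "ennreal \<Rightarrow> ennreal" where
  "ennreal_sqrt x = (if x = \<infinity> then \<infinity> else ennreal (sqrt (enn2real x)))"

text \<open>No second moments are required, so the value may be infinite. On a product
  \<^typ>\<open>'a \<times> 'b\<close> of Euclidean spaces, \<^const>\<open>dist\<close> is the Euclidean distance.\<close>

definition W2 :: "'a::{metric_space, second_countable_topology} measure \<Rightarrow> 'a measure \<Rightarrow> ennreal" where
  "W2 \<mu> \<nu> = ennreal_sqrt (INF \<pi>\<in>couplings \<mu> \<nu>. \<integral>\<^sup>+z. ennreal ((dist (fst z) (snd z))\<^sup>2) \<partial>\<pi>)"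


section \<open>Brownian motion and the kinetic Langevin diffusion\<close>

text \<open>Processes are indexed by all reals, but only times \<open>t \<ge> 0\<close> are ever constrained or used.
  The second argument of \<^const>\<open>normal_density\<close> is the standard deviation.\<close>

definition brownian_motion :: "'w measure \<Rightarrow> (real \<Rightarrow> 'w \<Rightarrow> real^'p) \<Rightarrow> bool" where
  "brownian_motion \<Omega> W \<longleftrightarrow>
     prob_space \<Omega> \<and>
     (\<forall>t\<ge>0. W t \<in> borel_measurable \<Omega>) \<and>
     (AE \<omega> in \<Omega>. W 0 \<omega> = 0) \<and>
     (AE \<omega> in \<Omega>. continuous_on {0..} (\<lambda>t. W t \<omega>)) \<and>
     (\<forall>\<tau> :: nat \<Rightarrow> real. 0 \<le> \<tau> 0 \<and> strict_mono \<tau> \<longrightarrow>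
        prob_space.indep_vars \<Omega> (\<lambda>_. borel) (\<lambda>i \<omega>. W (\<tau> (Suc i)) \<omega> - W (\<tau> i) \<omega>) UNIV) \<and>
     (\<forall>s t. 0 \<le> s \<and> s < t \<longrightarrow>
        distributed \<Omega> lborel (\<lambda>\<omega>. W t \<omega> - W s \<omega>)
          (\<lambda>x. ennreal (\<Prod>i\<in>UNIV. normal_density 0 (sqrt (t - s)) (x $ i))))"

text \<open>\<open>kinetic_langevin \<gamma> f \<mu> \<Omega> W V L\<close>: on \<open>\<Omega>\<close>, the process \<open>(V, L)\<close> is the strong solution of
  \<open>dV = - (\<gamma> V + \<nabla>f(L)) dt + \<surd>(2\<gamma>) dW\<close>, \<open>dL = V dt\<close>, driven by the Brownian motion \<open>W\<close>, with
  \<open>(V 0, L 0)\<close> of law \<open>\<mu>\<close> and independent of \<open>W\<close>. Since the noise is additive, the equation has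
  a pathwise meaning and no stochastic integral is needed. The clause about \<open>Y\<close> says that the
  solution is adapted to the filtration generated by \<open>(V 0, L 0)\<close> and \<open>W\<close>, completed by null sets.\<close>

definition kinetic_langevin ::
  "real \<Rightarrow> (real^'p \<Rightarrow> real) \<Rightarrow> ((real^'p) \<times> (real^'p)) measure \<Rightarrow> 'w measure \<Rightarrow>
   (real \<Rightarrow> 'w \<Rightarrow> real^'p) \<Rightarrow> (real \<Rightarrow> 'w \<Rightarrow> real^'p) \<Rightarrow> (real \<Rightarrow> 'w \<Rightarrow> real^'p) \<Rightarrow> bool" where
  "kinetic_langevin \<gamma> f \<mu> \<Omega> W V L \<longleftrightarrow>
     brownian_motion \<Omega> W \<and>
     (\<forall>t\<ge>0. V t \<in> borel_measurable \<Omega> \<and> L t \<in> borel_measurable \<Omega>) \<and>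
     distr \<Omega> borel (\<lambda>\<omega>. (V 0 \<omega>, L 0 \<omega>)) = \<mu> \<and>
     prob_space.indep_set \<Omega>
       (sets (vimage_algebra (space \<Omega>) (\<lambda>\<omega>. (V 0 \<omega>, L 0 \<omega>)) borel))
       (sets (vimage_algebra (space \<Omega>) (\<lambda>\<omega>. \<lambda>s\<in>{0..}. W s \<omega>) (\<Pi>\<^sub>M s\<in>{0..}. borel))) \<and>
     (\<forall>t\<ge>0. \<exists>Y \<in> borel_measurable (vimage_algebra (space \<Omega>)
                   (\<lambda>\<omega>. ((V 0 \<omega>, L 0 \<omega>), \<lambda>s\<in>{0..t}. W s \<omega>))
                   (borel \<Otimes>\<^sub>M (\<Pi>\<^sub>M s\<in>{0..t}. borel))).
        AE \<omega> in \<Omega>. (V t \<omega>, L t \<omega>) = Y \<omega>) \<and>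
     (AE \<omega> in \<Omega>.
        continuous_on {0..} (\<lambda>t. V t \<omega>) \<and> continuous_on {0..} (\<lambda>t. L t \<omega>) \<and>
        (\<forall>t\<ge>0.
           V t \<omega> = V 0 \<omega> - integral {0..t} (\<lambda>s. \<gamma> *\<^sub>R V s \<omega> + grad f (L s \<omega>))
                    + sqrt (2 * \<gamma>) *\<^sub>R W t \<omega> \<and>
           L t \<omega> = L 0 \<omega> + integral {0..t} (\<lambda>s. V s \<omega>)))"

end

theory Submission
  imports Defs
begin

text \<open>Synchronous coupling. Two solutions with the same noise and the same initial velocity differ by
  \<open>(x, y)\<close>, and in the coordinates \<open>p = x + v y\<close>, \<open>q = x + (\<gamma> - v) y\<close> the squared norm
  \<open>|p|\<^sup>2 + |q|\<^sup>2\<close> decays at twice the stated rate. To avoid an existence and uniqueness theory for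
  the equation, the contraction is proved, up to an error \<open>O(h)\<close>, for the explicit Euler scheme of
  step \<open>h\<close>. The scheme converges pathwise to any given solution and depends on the noise only
  through its increments over dyadic grids, whose joint law is the same for all Brownian
  motions. Hence the law of the position at time \<open>t\<close> is the image of (initial law) \<open>\<otimes>\<close> (law of the
  increments) under the limit of the Euler schemes, and two such limits can be coupled by feeding
  them the same velocity and increments.\<close>

subsection \<open>The gradient\<close>

text \<open>The two solutions live on unrelated probability spaces, each with its own Brownian
  motion, so their paths cannot be subtracted. Both have to be rebuilt from a common random input by
  one deterministic map. The coordinates come from the drift. With w = \<gamma> - v and D = \<gamma>
  - 2 v the difference satisfies p' = -(w x + H) and q' = -(v x + H), where H is the difference of
  the gradients, and D y = q - p, D x = w p - v q. If H = c y with a scalar c, all cross terms in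
  the derivative of |p|^2 + |q|^2 cancel; up to the factor 2/D it is (v^2 - c)|q|^2 + (c -
  w^2)|p|^2. The true Hessian deviates from c = (m + M)/2 by at most (M - m)/2, which turns the
  coefficients into v^2 - m and M - w^2. The prefactor is the cost of changing norms: equal initial
  velocities give |p|^2 + |q|^2 = (v^2 + w^2)|y|^2 at time 0, and D^2 |y|^2 = |q - p|^2 \<le>
  2(|p|^2 + |q|^2) at time t.\<close>

lemma symmetric_matrix_norm_bound:
  fixes A :: "real^'n^'n"
  assumes sym: "transpose A = A"
    and bound: "\<And>x. \<bar>x \<bullet> (A *v x)\<bar> \<le> r * (x \<bullet> x)"
  shows "norm (A *v x) \<le> r * norm x"
proof (cases "A *v x = 0 \<or> x = 0")
  case True
  then show ?thesis
  proof
    assume 0: "A *v x = 0"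
    show ?thesis
    proof (cases "x = 0")
      case False
      have "0 \<le> r * (norm x)\<^sup>2"
        using bound[of x] by (simp add: power2_norm_eq_inner)
      then have "0 \<le> r"
        using False by (simp add: zero_le_mult_iff)
      then show ?thesis using 0 by simp
    qed simp
  qed simp
next
  case False
  define a b where "a = norm x" and "b = norm (A *v x)"
  have ab: "a > 0" "b > 0"
    using False by (auto simp: a_def b_def)
  \<comment> \<open>Scaled to the length of x, in the direction of A x. Polarization and the
    parallelogram law then give 4 (y . A x) \<le> 4 r |x|^2, while y . A x = |x| |A x|.\<close>
  define y where "y = (a / b) *\<^sub>R (A *v x)"
  have yx: "y \<bullet> (A *v x) = a * b"
    using ab by (simp add: y_def dot_square_norm b_def[symmetric] power2_eq_square)
  have yy: "y \<bullet> y = a\<^sup>2"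
    using ab by (simp add: y_def dot_square_norm b_def[symmetric] power2_eq_square)
  have xx: "x \<bullet> x = a\<^sup>2"
    by (simp add: a_def dot_square_norm)
  have xy: "x \<bullet> (A *v y) = y \<bullet> (A *v x)"
    by (metis dot_lmul_matrix inner_commute sym transpose_matrix_vector)
  have "4 * (y \<bullet> (A *v x)) = (x + y) \<bullet> (A *v (x + y)) - (x - y) \<bullet> (A *v (x - y))"
    using xy by (simp add: matrix_vector_right_distrib matrix_vector_mult_diff_distrib
        inner_add_left inner_add_right inner_diff_left inner_diff_right)
  also have "\<dots> \<le> r * ((x + y) \<bullet> (x + y)) + r * ((x - y) \<bullet> (x - y))"
    using bound[of "x + y"] bound[of "x - y"] by linarith
  also have "\<dots> = 4 * r * a\<^sup>2"
    using xx yy by (simp add: inner_add_left inner_add_right inner_diff_left inner_diff_right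
        inner_commute[of y x] algebra_simps)
  finally have "b \<le> r * a"
    using ab yx by (simp add: power2_eq_square)
  then show ?thesis
    by (simp add: a_def b_def)
qed

text \<open>Subtracting the midpoint c = (m + M)/2 turns the two-sided Hessian bound into one bound
  (M - m)/2 on the operator norm of the derivative of grad f - c id, and the mean value inequality
  applies. In this form both m and M survive in an inequality between two values of
  \<open>grad f\<close>, which is all that the Euler scheme sees.\<close>

lemma grad_diff_near_midpoint:
  fixes f :: "real^'p \<Rightarrow> real"
  assumes diff: "\<And>x. grad f differentiable (at x)"
    and lo: "\<And>x. loewner_le (mat m) (hessian f x)"
    and hi: "\<And>x. loewner_le (hessian f x) (mat M)"
  shows "norm (grad f x - grad f y - ((m + M) / 2) *\<^sub>R (x - y)) \<le> (M - m) / 2 * norm (x - y)"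
proof -
  let ?c = "(m + M) / 2"
  have smul: "(mat k :: real^'p^'p) *v u = k *\<^sub>R u" for k u
    by (simp add: vec_eq_iff matrix_vector_mult_def mat_def if_distrib[of "\<lambda>a. a * _"] cong: if_cong)
  have der: "((\<lambda>x. grad f x - ?c *\<^sub>R x) has_derivative (\<lambda>h. (hessian f x - mat ?c) *v h)) (at x)" for x
  proof -
    have "(grad f has_derivative (\<lambda>h. hessian f x *v h)) (at x)"
      using diff[of x] by (simp add: hessian_def jacobian_works)
    then show ?thesis
      by (auto intro!: derivative_eq_intros simp: matrix_vector_mult_diff_rdistrib smul)
  qed
  have on: "onorm (\<lambda>h. (hessian f x - mat ?c) *v h) \<le> (M - m) / 2" for x
  proof (rule onorm_le, rule symmetric_matrix_norm_bound)
    \<comment> \<open>\<open>loewner_le\<close> demands a symmetric difference; as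
      \<open>mat m\<close> is symmetric, so is the Hessian.\<close>
    have "transpose (hessian f x - mat m) = hessian f x - mat m"
      using lo[of x] by (simp add: loewner_le_def)
    then have entry: "transpose (hessian f x - mat m) $ i $ j = (hessian f x - mat m) $ i $ j" for i j
      by simp
    have "hessian f x $ j $ i = hessian f x $ i $ j" for i j
      using entry[of i j] by (cases "i = j") (simp_all add: transpose_def mat_def)
    then show "transpose (hessian f x - mat ?c) = hessian f x - mat ?c"
      by (simp add: transpose_def vec_eq_iff mat_def)
    fix u :: "real^'p"
    have "0 \<le> u \<bullet> ((hessian f x - mat m) *v u)" "0 \<le> u \<bullet> ((mat M - hessian f x) *v u)"
      using lo[of x] hi[of x] by (auto simp: loewner_le_def)
    then show "\<bar>u \<bullet> ((hessian f x - mat ?c) *v u)\<bar> \<le> (M - m) / 2 * (u \<bullet> u)"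
      by (simp add: matrix_vector_mult_diff_rdistrib smul inner_diff_right abs_le_iff field_simps)
  qed
  have "norm ((grad f x - ?c *\<^sub>R x) - (grad f y - ?c *\<^sub>R y)) \<le> (M - m) / 2 * norm (x - y)"
    by (rule differentiable_bound[OF convex_UNIV has_derivative_at_withinI[OF der] on]) auto
  then show ?thesis
    by (simp add: algebra_simps)
qed

subsection \<open>The Euler scheme\<close>

text \<open>The noise is an arbitrary sequence, so that two runs can be fed the same increments and
  compared path by path.\<close>

primrec euler_scheme :: "('a::real_vector \<Rightarrow> 'a) \<Rightarrow> real \<Rightarrow> (nat \<Rightarrow> 'a) \<Rightarrow> 'a \<Rightarrow> nat \<Rightarrow> 'a" where
  "euler_scheme b h \<xi> z 0 = z"
| "euler_scheme b h \<xi> z (Suc k) =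
     euler_scheme b h \<xi> z k + h *\<^sub>R b (euler_scheme b h \<xi> z k) + \<xi> k"

text \<open>A deterministic statement about one path. The scheme receives the exact increments of
  \<open>N\<close>, so the noise contributes no error; a step of length h errs by at most h times
  the oscillation of b (Z r) over that step, and a discrete Gronwall argument accumulates these
  errors.\<close>

lemma euler_scheme_tendsto:
  fixes Z N :: "real \<Rightarrow> 'a::euclidean_space"
  assumes K: "K \<ge> 0" and lip: "\<And>x y. norm (b x - b y) \<le> K * norm (x - y)"
    and t: "t > 0" and cont: "continuous_on {0..t} Z"
    and eq: "\<And>s. s \<in> {0..t} \<Longrightarrow> Z s = Z 0 + integral {0..s} (\<lambda>r. b (Z r)) + N s"
  shows "(\<lambda>n. euler_scheme b (t / 2^n)
            (\<lambda>k. N (real (Suc k) * (t / 2^n)) - N (real k * (t / 2^n))) (Z 0) (2^n)) \<longlonglongrightarrow> Z t"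
proof -
  define g where "g r = b (Z r)" for r
  have "continuous_on UNIV b"
    by (rule lipschitz_on_continuous_on[of K]) (auto intro!: lipschitz_onI lip K simp: dist_norm)
  then have g: "continuous_on {0..t} g"
    unfolding g_def using cont continuous_on_compose2 by blast
  have step: "norm (Z (a + h) - Z a - (N (a + h) - N a) - h *\<^sub>R g a) \<le> \<epsilon> * h"
    if "0 \<le> a" "0 \<le> h" "a + h \<le> t" and small: "\<And>r. r \<in> {a..a + h} \<Longrightarrow> norm (g r - g a) \<le> \<epsilon>"
    for a h \<epsilon>
  proof -
    have int: "g integrable_on {c..d}" and cnt: "continuous_on {c..d} g" if "0 \<le> c" "d \<le> t" for c d
    proof -
      show "continuous_on {c..d} g"
        using continuous_on_subset[OF g] that by auto
      then show "g integrable_on {c..d}"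
        by (rule integrable_continuous_real)
    qed
    have "integral {0..a} g + integral {a..a + h} g = integral {0..a + h} g"
      using that by (intro Henstock_Kurzweil_Integration.integral_combine int) auto
    then have "Z (a + h) - Z a - (N (a + h) - N a) = integral {a..a + h} g"
      using eq[of a] eq[of "a + h"] that by (simp add: g_def[abs_def] algebra_simps)
    also have "\<dots> - h *\<^sub>R g a = integral {a..a + h} (\<lambda>r. g r - g a)"
      using that by (subst Henstock_Kurzweil_Integration.integral_diff) (auto intro!: int)
    also have "norm \<dots> \<le> \<epsilon> * (a + h - a)"
      using that by (intro integral_bound continuous_intros cnt) auto
    finally show ?thesis by simp
  qed
  show ?thesis
  proof (rule LIMSEQ_I)
    fix \<eta> :: real
    assume \<eta>: "\<eta> > 0"
    \<comment> \<open>Chosen so that the accumulated error \<epsilon> t exp (K t) equals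
      \<eta>/2.\<close>
    define \<epsilon> where "\<epsilon> = \<eta> / (2 * t * exp (K * t))"
    have \<epsilon>: "\<epsilon> > 0"
      using \<eta> t by (simp add: \<epsilon>_def)
    obtain \<delta> where \<delta>: "\<delta> > 0" "\<And>r s. r \<in> {0..t} \<Longrightarrow> s \<in> {0..t} \<Longrightarrow> dist s r < \<delta> \<Longrightarrow> dist (g s) (g r) < \<epsilon>"
      using compact_uniformly_continuous[OF g compact_Icc] \<epsilon>
      unfolding uniformly_continuous_on_def by metis
    have "(\<lambda>n. t / 2^n) \<longlonglongrightarrow> 0"
      by real_asymp
    then obtain n0 where n0: "\<And>n. n \<ge> n0 \<Longrightarrow> t / 2^n < \<delta>"
      using \<delta>(1) t by (auto simp: lim_sequentially)
    show "\<exists>no. \<forall>n\<ge>no. norm (euler_scheme b (t / 2^n)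
            (\<lambda>k. N (real (Suc k) * (t / 2^n)) - N (real k * (t / 2^n))) (Z 0) (2^n) - Z t) < \<eta>"
    proof (intro exI allI impI)
      fix n assume "n \<ge> n0"
      define h where "h = t / 2^n"
      have h: "0 < h" "h < \<delta>" "h * 2^n = t"
        using n0[OF \<open>n \<ge> n0\<close>] t by (auto simp: h_def)
      define E where "E = euler_scheme b h (\<lambda>k. N (real (Suc k) * h) - N (real k * h)) (Z 0)"
      \<comment> \<open>A step multiplies the error by at most 1 + K h \<le> exp (K h) and adds at
        most \<epsilon> h. The added term is also given the exponential factor, which is at least 1,
        so that the bound reproduces itself.\<close>
      have err: "norm (E k - Z (real k * h)) \<le> \<epsilon> * h * real k * exp (K * h * real k)" if "k \<le> 2^n" for k
        using that
      proof (induction k)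
        case 0
        then show ?case by (simp add: E_def)
      next
        case (Suc k)
        let ?a = "real k * h"
        let ?e = "norm (E k - Z ?a)"
        have kh: "real (Suc k) * h \<le> t"
        proof -
          have "real (Suc k) \<le> 2^n"
            using Suc.prems of_nat_mono[of "Suc k" "2^n", where 'a=real] by simp
          then have "real (Suc k) * h \<le> 2^n * h"
            using h by (intro mult_right_mono) auto
          then show ?thesis
            using h(3) by (simp only: mult.commute)
        qed
        have a: "0 \<le> ?a" "?a + h \<le> t" "real (Suc k) * h = ?a + h"
          using kh h by (auto simp: algebra_simps)
        have "norm (Z (?a + h) - Z ?a - (N (?a + h) - N ?a) - h *\<^sub>R g ?a) \<le> \<epsilon> * h"
        proof (rule step)
          fix r assume "r \<in> {?a..?a + h}"
          then have r: "?a \<le> r" "r \<le> ?a + h"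
            by auto
          then have "r \<in> {0..t}" "?a \<in> {0..t}" "dist r ?a < \<delta>"
          proof -
            have "0 \<le> r"
              using order_trans[OF a(1) r(1)] .
            moreover have "r \<le> t"
              using order_trans[OF r(2) a(2)] .
            ultimately show "r \<in> {0..t}"
              by simp
            show "?a \<in> {0..t}" "dist r ?a < \<delta>"
              using a r h by (auto simp: dist_real_def)
          qed
          then show "norm (g r - g ?a) \<le> \<epsilon>"
            using \<delta>(2)[of ?a r] by (simp add: dist_norm less_imp_le)
        qed (use a h in auto)
        note loc = this
        have "E (Suc k) = E k + h *\<^sub>R b (E k) + (N (?a + h) - N ?a)"
          unfolding E_def euler_scheme.simps a(3) ..
        then have eq: "E (Suc k) - Z (?a + h) = (E k - Z ?a) + h *\<^sub>R (b (E k) - b (Z ?a))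
            - (Z (?a + h) - Z ?a - (N (?a + h) - N ?a) - h *\<^sub>R g ?a)"
          by (simp add: g_def scaleR_diff_right)
        have "norm (h *\<^sub>R (b (E k) - b (Z ?a))) \<le> h * (K * ?e)"
          using lip[of "E k" "Z ?a"] h by (simp add: mult_left_mono)
        then have "norm ((E k - Z ?a) + h *\<^sub>R (b (E k) - b (Z ?a))) \<le> ?e + h * (K * ?e)"
          by (rule norm_triangle_le[OF add_left_mono])
        then have "norm (E (Suc k) - Z (?a + h)) \<le> ?e + h * (K * ?e) + \<epsilon> * h"
          unfolding eq by (rule order_trans[OF norm_triangle_ineq4 add_mono[OF _ loc]])
        also have "\<dots> = ?e * (1 + K * h) + \<epsilon> * h"
          by (simp add: algebra_simps)
        also have "\<dots> \<le> (\<epsilon> * h * real k * exp (K * h * real k)) * exp (K * h) + \<epsilon> * h * exp (K * h * real (Suc k))"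
        proof (rule add_mono)
          have "1 \<le> exp (K * h * real (Suc k))"
            using h K by simp
          then show "\<epsilon> * h \<le> \<epsilon> * h * exp (K * h * real (Suc k))"
            using mult_left_mono[of 1 _ "\<epsilon> * h"] h \<epsilon> by simp
          show "?e * (1 + K * h) \<le> \<epsilon> * h * real k * exp (K * h * real k) * exp (K * h)"
            using Suc h K \<epsilon> by (intro mult_mono exp_ge_add_one_self) auto
        qed
        also have "\<dots> = \<epsilon> * h * real (Suc k) * exp (K * h * real (Suc k))"
          by (simp add: algebra_simps flip: exp_add)
        finally show ?case
          using a(3) by simp
      qed
      have "norm (E (2^n) - Z t) \<le> \<epsilon> * t * exp (K * t)"
      proof -
        have eqs: "real (2^n) * h = t" "\<epsilon> * h * real (2^n) = \<epsilon> * t" "K * h * real (2^n) = K * t"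
          using h(3) by (simp_all add: mult.assoc mult.commute[of h])
        then show ?thesis
          using err[OF order_refl] by (simp only: eqs)
      qed
      also have "\<dots> < \<eta>"
        using \<eta> t by (simp add: \<epsilon>_def)
      finally show "norm (euler_scheme b (t / 2^n)
          (\<lambda>k. N (real (Suc k) * (t / 2^n)) - N (real k * (t / 2^n))) (Z 0) (2^n) - Z t) < \<eta>"
        by (simp add: E_def h_def)
    qed
  qed
qed

subsection \<open>Contraction\<close>

definition langevin_drift :: "real \<Rightarrow> ('a::real_vector \<Rightarrow> 'a) \<Rightarrow> 'a \<times> 'a \<Rightarrow> 'a \<times> 'a" where
  "langevin_drift \<gamma> g z = (- (\<gamma> *\<^sub>R fst z + g (snd z)), fst z)"

lemma langevin_drift_lipschitz:
  fixes g :: "'a::real_inner \<Rightarrow> 'a"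
  assumes "\<gamma> \<ge> 0" "B \<ge> 0" and g: "\<And>x y. norm (g x - g y) \<le> B * norm (x - y)"
  shows "norm (langevin_drift \<gamma> g z - langevin_drift \<gamma> g z') \<le> (1 + \<gamma> + B) * norm (z - z')"
proof -
  have 1: "norm (fst z - fst z') \<le> norm (z - z')" "norm (snd z - snd z') \<le> norm (z - z')"
    using norm_fst_le[of "fst (z - z')" "snd (z - z')"] norm_snd_le[of "snd (z - z')" "fst (z - z')"]
    unfolding prod.collapse by simp_all
  let ?d = "langevin_drift \<gamma> g z - langevin_drift \<gamma> g z'"
  have "norm (fst ?d) \<le> \<gamma> * norm (fst z - fst z') + norm (g (snd z) - g (snd z'))"
  proof -
    have "fst ?d = - (\<gamma> *\<^sub>R (fst z - fst z')) - (g (snd z) - g (snd z'))"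
      by (simp add: langevin_drift_def algebra_simps)
    then show ?thesis
      using assms(1) norm_triangle_ineq4[of "- (\<gamma> *\<^sub>R (fst z - fst z'))" "g (snd z) - g (snd z')"] by simp
  qed
  also have "\<dots> \<le> \<gamma> * norm (z - z') + B * norm (z - z')"
    using assms 1 by (intro add_mono order.trans[OF g] mult_left_mono) auto
  finally have "norm (fst ?d) \<le> (\<gamma> + B) * norm (z - z')"
    by (simp add: algebra_simps)
  moreover have "norm (snd ?d) \<le> norm (z - z')"
    using 1 by (simp add: langevin_drift_def)
  moreover have "norm ?d \<le> norm (fst ?d) + norm (snd ?d)"
    using norm_Pair_le[of "fst ?d" "snd ?d"] unfolding prod.collapse .
  ultimately show ?thesis
    by (simp add: algebra_simps)
qed

text \<open>The left side is half the time derivative of |p|^2 + |q|^2 for the differential equation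
  behind the Euler step. Splitting H = c y + e at the midpoint c isolates a diagonal form. After
  multiplication by D the remainder e costs at most (M - m)/2 times |p|^2 + |q|^2, which lowers c to
  m in one coefficient and raises it to M in the other.\<close>

lemma lyapunov_rate_bound:
  fixes p q H :: "'a::real_inner"
  assumes D: "D > 0" and w: "w = v + D" and mM: "m \<le> M"
    and y: "y = (1 / D) *\<^sub>R (q - p)" and x: "x = p - v *\<^sub>R y"
    and H: "norm (H - ((m + M) / 2) *\<^sub>R y) \<le> (M - m) / 2 * norm y"
  shows "- (p \<bullet> (w *\<^sub>R x + H)) - q \<bullet> (v *\<^sub>R x + H)
    \<le> max (v\<^sup>2 - m) (M - w\<^sup>2) / D * (p \<bullet> p + q \<bullet> q)"
proof -
  let ?c = "(m + M) / 2" and ?r = "(M - m) / 2" and ?\<mu> = "max (v\<^sup>2 - m) (M - w\<^sup>2)"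
  define e where "e = H - ?c *\<^sub>R y"
  have He: "H = ?c *\<^sub>R y + e"
    by (simp add: e_def)
  have e: "norm e \<le> ?r * norm (q - p) / D"
    using H D by (simp add: e_def y)
  \<comment> \<open>The inequality 2ab \<le> a^2 + b^2 and the parallelogram law; the constant 1 is
    what makes the remainder cost exactly (M - m)/2.\<close>
  have "norm (p + q) * norm (q - p) \<le> ((norm (p + q))\<^sup>2 + (norm (q - p))\<^sup>2) / 2"
    using sum_squares_bound[of "norm (p + q)" "norm (q - p)"] by simp
  also have "\<dots> = p \<bullet> p + q \<bullet> q"
    by (simp add: power2_norm_eq_inner inner_add_left inner_add_right inner_diff_left inner_diff_right
        inner_commute)
  finally have pq: "norm (p + q) * norm (q - p) \<le> p \<bullet> p + q \<bullet> q" .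
  have "- ((p + q) \<bullet> e) \<le> norm (p + q) * norm e"
    using norm_cauchy_schwarz[of "- (p + q)" e] by (simp del: minus_add_distrib)
  also have "\<dots> \<le> norm (p + q) * (?r * norm (q - p) / D)"
    using e by (intro mult_left_mono) auto
  also have "\<dots> = ?r / D * (norm (p + q) * norm (q - p))"
    by simp
  also have "\<dots> \<le> ?r / D * (p \<bullet> p + q \<bullet> q)"
    using pq mM D by (intro mult_left_mono) auto
  finally have e': "- ((p + q) \<bullet> e) * D \<le> ?r * (p \<bullet> p + q \<bullet> q)"
    using D by (simp add: field_simps)
  have Dy: "D *\<^sub>R y = q - p"
    using D by (simp add: y)
  have Dx: "D *\<^sub>R x = w *\<^sub>R p - v *\<^sub>R q"
  proof -
    have "D *\<^sub>R x = D *\<^sub>R p - v *\<^sub>R (D *\<^sub>R y)"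
      by (simp add: x scaleR_diff_right)
    then show ?thesis
      by (simp add: Dy w algebra_simps)
  qed
  \<comment> \<open>The products v w (p . q) coming from the first two terms have opposite signs,
    and (p + q) . (q - p) is |q|^2 - |p|^2.\<close>
  have quad: "- w * (p \<bullet> (w *\<^sub>R p - v *\<^sub>R q)) - v * (q \<bullet> (w *\<^sub>R p - v *\<^sub>R q)) - c * ((p + q) \<bullet> (q - p))
    = (v\<^sup>2 - c) * (q \<bullet> q) + (c - w\<^sup>2) * (p \<bullet> p)" for c
    by (simp add: inner_add_left inner_add_right inner_diff_left inner_diff_right
        inner_commute power2_eq_square algebra_simps)
  have "(- (p \<bullet> (w *\<^sub>R x + H)) - q \<bullet> (v *\<^sub>R x + H)) * D
    = - w * (p \<bullet> D *\<^sub>R x) - v * (q \<bullet> D *\<^sub>R x) - ?c * ((p + q) \<bullet> D *\<^sub>R y) - ((p + q) \<bullet> e) * D"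
    unfolding He by (simp add: algebra_simps inner_add_left inner_add_right)
  also have "\<dots> = (v\<^sup>2 - ?c) * (q \<bullet> q) + (?c - w\<^sup>2) * (p \<bullet> p) - ((p + q) \<bullet> e) * D"
    unfolding Dx Dy quad ..
  also have "\<dots> \<le> (v\<^sup>2 - ?c) * (q \<bullet> q) + (?c - w\<^sup>2) * (p \<bullet> p) + ?r * (p \<bullet> p + q \<bullet> q)"
    using e' by simp
  also have "\<dots> = (v\<^sup>2 - m) * (q \<bullet> q) + (M - w\<^sup>2) * (p \<bullet> p)"
    by (simp add: field_simps)
  also have "\<dots> \<le> ?\<mu> * (q \<bullet> q) + ?\<mu> * (p \<bullet> p)"
    by (intro add_mono mult_right_mono) auto
  finally show ?thesis
    using D by (simp add: field_simps)
qed

text \<open>One step of the Euler scheme for the difference \<open>(x, y)\<close> of two solutions driven by the same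
  noise, with friction \<open>\<gamma> = v + w\<close>.\<close>

lemma langevin_euler_step:
  fixes m M v w D :: real
  assumes D: "D > 0" and w: "w = v + D" and mM: "m \<le> M"
  obtains C where "\<And>(p::'a::real_inner) q x y H h. 0 \<le> h \<Longrightarrow> p = x + v *\<^sub>R y \<Longrightarrow> q = x + w *\<^sub>R y \<Longrightarrow>
      norm (H - ((m + M) / 2) *\<^sub>R y) \<le> (M - m) / 2 * norm y \<Longrightarrow>
      (norm (p - h *\<^sub>R (w *\<^sub>R x + H)))\<^sup>2 + (norm (q - h *\<^sub>R (v *\<^sub>R x + H)))\<^sup>2
        \<le> exp (2 * h * (max (v\<^sup>2 - m) (M - w\<^sup>2) / D) + C * h\<^sup>2) * ((norm p)\<^sup>2 + (norm q)\<^sup>2)"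
proof -
  \<comment> \<open>\<open>A\<close> bounds |H| by A |y|, and \<open>B\<close> bounds both |w x + H|
    and |v x + H| by B (|p| + |q|). The constant finally supplied for C is 4 B^2.\<close>
  define A where "A = \<bar>(m + M) / 2\<bar> + (M - m) / 2"
  define B where "B = (\<bar>w\<bar> + \<bar>v\<bar>) * (1 + \<bar>v\<bar> / D) + A / D"
  have A0: "A \<ge> 0" and B0: "B \<ge> 0"
    using mM D by (auto simp: A_def B_def)
  let ?l = "max (v\<^sup>2 - m) (M - w\<^sup>2) / D"
  show ?thesis
  proof (rule that)
    fix p q x y H :: 'a and h :: real
    assume h: "0 \<le> h" and p: "p = x + v *\<^sub>R y" and q: "q = x + w *\<^sub>R y"
      and H: "norm (H - ((m + M) / 2) *\<^sub>R y) \<le> (M - m) / 2 * norm y"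
    let ?P = "w *\<^sub>R x + H" and ?Q = "v *\<^sub>R x + H" and ?n = "norm p + norm q"
    have y: "y = (1 / D) *\<^sub>R (q - p)"
      using D by (simp add: p q w algebra_simps)
    have x: "x = p - v *\<^sub>R y"
      by (simp add: p)
    have drift: "- (p \<bullet> ?P) - q \<bullet> ?Q \<le> ?l * (p \<bullet> p + q \<bullet> q)"
      by (rule lyapunov_rate_bound[OF D w mM y x H])
    have ny: "norm y \<le> ?n / D"
      using D norm_triangle_ineq4[of q p] by (simp add: y divide_right_mono)
    have "norm x \<le> norm p + \<bar>v\<bar> * norm y"
      using norm_triangle_ineq4[of p "v *\<^sub>R y"] x by simp
    also have "\<dots> \<le> ?n + \<bar>v\<bar> * (?n / D)"
      using ny by (intro add_mono mult_left_mono) auto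
    finally have nx: "norm x \<le> (1 + \<bar>v\<bar> / D) * ?n"
      by (simp add: algebra_simps add_divide_distrib)
    have "norm H \<le> norm (((m + M) / 2) *\<^sub>R y) + (M - m) / 2 * norm y"
      using H norm_triangle_sub[of H "((m + M) / 2) *\<^sub>R y"] by simp
    also have "\<dots> = A * norm y"
      by (simp add: A_def algebra_simps)
    also have "\<dots> \<le> A * (?n / D)"
      using ny A0 by (intro mult_left_mono) auto
    finally have nH: "norm H \<le> A / D * ?n"
      by simp
    have bd: "norm (c *\<^sub>R x + H) \<le> B * ?n" if "\<bar>c\<bar> \<le> \<bar>w\<bar> + \<bar>v\<bar>" for c
    proof -
      have "norm (c *\<^sub>R x + H) \<le> \<bar>c\<bar> * norm x + norm H"
        by (metis norm_scaleR norm_triangle_ineq)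
      also have "\<dots> \<le> (\<bar>w\<bar> + \<bar>v\<bar>) * ((1 + \<bar>v\<bar> / D) * ?n) + A / D * ?n"
        using that nx nH D by (intro add_mono mult_mono) auto
      also have "\<dots> = B * ?n"
        unfolding B_def by (simp only: distrib_right mult.assoc)
      finally show ?thesis .
    qed
    have n2: "?n\<^sup>2 \<le> 2 * ((norm p)\<^sup>2 + (norm q)\<^sup>2)"
      using sum_squares_bound[of "norm p" "norm q"] by (simp add: power2_sum)
    have sq: "(norm (c *\<^sub>R x + H))\<^sup>2 \<le> 2 * B\<^sup>2 * ((norm p)\<^sup>2 + (norm q)\<^sup>2)" if "\<bar>c\<bar> \<le> \<bar>w\<bar> + \<bar>v\<bar>" for c
    proof -
      have "(norm (c *\<^sub>R x + H))\<^sup>2 \<le> (B * ?n)\<^sup>2"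
        using bd[OF that] by (intro power_mono) auto
      also have "\<dots> \<le> B\<^sup>2 * (2 * ((norm p)\<^sup>2 + (norm q)\<^sup>2))"
        using n2 by (simp add: power_mult_distrib mult_left_mono)
      finally show ?thesis by (simp add: algebra_simps)
    qed
    have expand: "(norm (a - h *\<^sub>R c))\<^sup>2 = (norm a)\<^sup>2 - 2 * h * (a \<bullet> c) + h\<^sup>2 * (norm c)\<^sup>2" for a c :: 'a
      unfolding power2_norm_eq_inner
      by (simp add: inner_diff_left inner_diff_right inner_commute power2_eq_square algebra_simps)
    let ?S = "(norm p)\<^sup>2 + (norm q)\<^sup>2"
    have "(norm (p - h *\<^sub>R ?P))\<^sup>2 + (norm (q - h *\<^sub>R ?Q))\<^sup>2
      = ?S + 2 * h * (- (p \<bullet> ?P) - q \<bullet> ?Q) + h\<^sup>2 * ((norm ?P)\<^sup>2 + (norm ?Q)\<^sup>2)"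
      unfolding expand by (simp add: algebra_simps)
    also have "\<dots> \<le> ?S + 2 * h * (?l * ?S) + h\<^sup>2 * (2 * B\<^sup>2 * ?S + 2 * B\<^sup>2 * ?S)"
      using drift h sq[of w] sq[of v]
      by (intro add_mono mult_left_mono) (auto simp: power2_norm_eq_inner)
    also have "\<dots> = (1 + (2 * h * ?l + 4 * B\<^sup>2 * h\<^sup>2)) * ?S"
      by (simp add: algebra_simps)
    \<comment> \<open>1 + a \<le> exp a holds for every real a, so negative rates are covered and
      the factors of successive steps simply multiply.\<close>
    also have "\<dots> \<le> exp (2 * h * ?l + 4 * B\<^sup>2 * h\<^sup>2) * ?S"
      by (intro mult_right_mono exp_ge_add_one_self) auto
    finally show "(norm (p - h *\<^sub>R ?P))\<^sup>2 + (norm (q - h *\<^sub>R ?Q))\<^sup>2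
        \<le> exp (2 * h * ?l + 4 * B\<^sup>2 * h\<^sup>2) * ?S" .
  qed
qed

text \<open>Equal initial velocities mean p = v y and q = w y at the start, whence the factor
  (\<gamma> - v)^2 + v^2. \<open>C\<close> is uniform in the step, the number of steps, the noise
  and the starting points: over t/h steps the terms C h^2 add up to C t h, which vanishes with
  h.\<close>

lemma langevin_euler_contraction:
  fixes g :: "'a::real_inner \<Rightarrow> 'a" and m M v \<gamma> :: real
  assumes mM: "m \<le> M" and v: "2 * v < \<gamma>"
    and g: "\<And>x y. norm (g x - g y - ((m + M) / 2) *\<^sub>R (x - y)) \<le> (M - m) / 2 * norm (x - y)"
  obtains C where "\<And>h \<xi> u l l' k. 0 \<le> h \<Longrightarrow>
      (norm (snd (euler_scheme (langevin_drift \<gamma> g) h \<xi> (u, l) k)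
           - snd (euler_scheme (langevin_drift \<gamma> g) h \<xi> (u, l') k)))\<^sup>2
      \<le> 2 * ((\<gamma> - v)\<^sup>2 + v\<^sup>2) / (\<gamma> - 2 * v)\<^sup>2
        * exp (real k * (2 * h * (max (v\<^sup>2 - m) (M - (\<gamma> - v)\<^sup>2) / (\<gamma> - 2 * v)) + C * h\<^sup>2))
        * (norm (l - l'))\<^sup>2"
proof -
  define D w where "D = \<gamma> - 2 * v" and "w = \<gamma> - v"
  have D: "D > 0" "w = v + D" "\<gamma> = v + w"
    using v by (auto simp: D_def w_def)
  let ?l = "max (v\<^sup>2 - m) (M - w\<^sup>2) / D"
  obtain C where C: "\<And>(p::'a) q x y H h. 0 \<le> h \<Longrightarrow> p = x + v *\<^sub>R y \<Longrightarrow> q = x + w *\<^sub>R y \<Longrightarrow>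
      norm (H - ((m + M) / 2) *\<^sub>R y) \<le> (M - m) / 2 * norm y \<Longrightarrow>
      (norm (p - h *\<^sub>R (w *\<^sub>R x + H)))\<^sup>2 + (norm (q - h *\<^sub>R (v *\<^sub>R x + H)))\<^sup>2
        \<le> exp (2 * h * ?l + C * h\<^sup>2) * ((norm p)\<^sup>2 + (norm q)\<^sup>2)"
    using langevin_euler_step[OF D(1,2) mM, where 'a='a] by blast
  show ?thesis
  proof (rule that)
    fix h :: real and \<xi> :: "nat \<Rightarrow> 'a \<times> 'a" and u l l' :: 'a and k :: nat
    assume h: "0 \<le> h"
    define z z' where "z = euler_scheme (langevin_drift \<gamma> g) h \<xi> (u, l)"
      and "z' = euler_scheme (langevin_drift \<gamma> g) h \<xi> (u, l')"
    define x y where "x k = fst (z k) - fst (z' k)" and "y k = snd (z k) - snd (z' k)" for k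
    define p q where "p k = x k + v *\<^sub>R y k" and "q k = x k + w *\<^sub>R y k" for k
    define H where "H k = g (snd (z k)) - g (snd (z' k))" for k
    \<comment> \<open>The common noise \<xi> cancels in the difference of the two runs.\<close>
    have x': "x (Suc k) = x k - h *\<^sub>R (\<gamma> *\<^sub>R x k + H k)" for k
      by (simp add: x_def z_def z'_def H_def langevin_drift_def algebra_simps)
    have y': "y (Suc k) = y k + h *\<^sub>R x k" for k
      by (simp add: x_def y_def z_def z'_def langevin_drift_def algebra_simps)
    have p': "p (Suc k) = p k - h *\<^sub>R (w *\<^sub>R x k + H k)" for k
      unfolding p_def x' y' D(3) by (simp add: algebra_simps)
    have q': "q (Suc k) = q k - h *\<^sub>R (v *\<^sub>R x k + H k)" for k
      unfolding q_def x' y' D(3) by (simp add: algebra_simps)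
    let ?r = "2 * h * ?l + C * h\<^sup>2"
    have S: "(norm (p k))\<^sup>2 + (norm (q k))\<^sup>2 \<le> exp (real k * ?r) * ((norm (p 0))\<^sup>2 + (norm (q 0))\<^sup>2)" for k
    proof (induction k)
      case (Suc k)
      have "(norm (p (Suc k)))\<^sup>2 + (norm (q (Suc k)))\<^sup>2 \<le> exp ?r * ((norm (p k))\<^sup>2 + (norm (q k))\<^sup>2)"
        unfolding p' q' by (rule C[OF h p_def q_def]) (use g in \<open>simp add: H_def y_def\<close>)
      also have "\<dots> \<le> exp ?r * (exp (real k * ?r) * ((norm (p 0))\<^sup>2 + (norm (q 0))\<^sup>2))"
        using Suc by (intro mult_left_mono) auto
      also have "\<dots> = exp (real (Suc k) * ?r) * ((norm (p 0))\<^sup>2 + (norm (q 0))\<^sup>2)"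
      proof -
        have "exp ?r * exp (real k * ?r) = exp (real (Suc k) * ?r)"
          unfolding exp_add[symmetric] of_nat_Suc distrib_right by simp
        then show ?thesis
          by (simp only: mult.assoc[symmetric])
      qed
      finally show ?case .
    qed simp
    have "D\<^sup>2 * (norm (y k))\<^sup>2 = (norm (q k - p k))\<^sup>2"
      using D(1) by (simp add: p_def q_def D(2) power_mult_distrib flip: scaleR_diff_left)
    also have "\<dots> \<le> (norm (p k) + norm (q k))\<^sup>2"
      using norm_triangle_ineq4[of "q k" "p k"] by (intro power_mono) auto
    also have "\<dots> \<le> 2 * ((norm (p k))\<^sup>2 + (norm (q k))\<^sup>2)"
      using sum_squares_bound[of "norm (p k)" "norm (q k)"] by (simp add: power2_sum)
    also have "\<dots> \<le> 2 * (exp (real k * ?r) * ((norm (p 0))\<^sup>2 + (norm (q 0))\<^sup>2))"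
      using S[of k] by simp
    also have "(norm (p 0))\<^sup>2 + (norm (q 0))\<^sup>2 = (w\<^sup>2 + v\<^sup>2) * (norm (l - l'))\<^sup>2"
    proof -
      have "p 0 = v *\<^sub>R (l - l')" "q 0 = w *\<^sub>R (l - l')"
        by (simp_all add: p_def q_def x_def y_def z_def z'_def)
      then show ?thesis
        by (simp add: power_mult_distrib distrib_right)
    qed
    finally have "(norm (y k))\<^sup>2 \<le> 2 * (w\<^sup>2 + v\<^sup>2) / D\<^sup>2 * exp (real k * ?r) * (norm (l - l'))\<^sup>2"
      using D(1) by (simp add: field_simps)
    then show "(norm (snd (euler_scheme (langevin_drift \<gamma> g) h \<xi> (u, l) k)
           - snd (euler_scheme (langevin_drift \<gamma> g) h \<xi> (u, l') k)))\<^sup>2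
      \<le> 2 * ((\<gamma> - v)\<^sup>2 + v\<^sup>2) / (\<gamma> - 2 * v)\<^sup>2
        * exp (real k * (2 * h * (max (v\<^sup>2 - m) (M - (\<gamma> - v)\<^sup>2) / (\<gamma> - 2 * v)) + C * h\<^sup>2))
        * (norm (l - l'))\<^sup>2"
      by (simp add: y_def z_def z'_def D_def w_def)
  qed
qed

subsection \<open>The law of the dyadic increments\<close>

text \<open>Index pairs are (level, interval number). All levels form one countable family, so that
  the Euler schemes of all step sizes are functions of a single random element and their limit can
  be taken on its space.\<close>

definition dyadic_increments :: "real \<Rightarrow> (real \<Rightarrow> 'a::ab_group_add) \<Rightarrow> nat \<times> nat \<Rightarrow> 'a" where
  "dyadic_increments t w i =
     w (real (Suc (snd i)) * (t / 2 ^ fst i)) - w (real (snd i) * (t / 2 ^ fst i))"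

lemma dyadic_increments_refine:
  assumes "n \<le> N"
  shows "dyadic_increments t w (n, k) =
    (\<Sum>j<2 ^ (N - n). dyadic_increments t w (N, k * 2 ^ (N - n) + j))"
proof -
  define r where "r = (2::nat) ^ (N - n)"
  have r: "2 ^ N = real r * 2 ^ n"
    using assms by (simp add: r_def flip: power_add)
  have pos: "real r > 0"
    by (simp add: r_def)
  have "(\<Sum>j<r. dyadic_increments t w (N, k * r + j)) =
      (\<Sum>j<r. w (real (k * r + Suc j) * (t / 2 ^ N)) - w (real (k * r + j) * (t / 2 ^ N)))"
    by (simp add: dyadic_increments_def)
  also have "\<dots> = w (real (k * r + r) * (t / 2 ^ N)) - w (real (k * r) * (t / 2 ^ N))"
    by (subst sum_lessThan_telescope) simp
  also have "real (k * r + r) * (t / 2 ^ N) = real (Suc k) * (t / 2 ^ n)"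
    unfolding r using pos by (simp add: field_simps)
  also have "real (k * r) * (t / 2 ^ N) = real k * (t / 2 ^ n)"
    unfolding r using pos by (simp add: field_simps)
  finally show ?thesis
    by (simp add: dyadic_increments_def r_def)
qed

text \<open>Independence of noise and initial state is stated in \<open>kinetic_langevin\<close> for
  the path restricted to nonnegative times; this lets the increments be read off that
  restriction.\<close>

lemma dyadic_increments_restrict:
  assumes "t \<ge> 0"
  shows "dyadic_increments t (restrict w {0..}) = dyadic_increments t w"
  using assms by (simp add: dyadic_increments_def fun_eq_iff)

lemma measurable_dyadic_increments:
  fixes W :: "real \<Rightarrow> 'w \<Rightarrow> real^'p"
  assumes "t \<ge> 0" and "\<And>s. s \<ge> 0 \<Longrightarrow> W s \<in> borel_measurable \<Omega>"
  shows "(\<lambda>\<omega>. dyadic_increments t (\<lambda>s. W s \<omega>)) \<in> measurable \<Omega> (\<Pi>\<^sub>M i\<in>UNIV. borel)"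
proof (rule measurable_PiM_single')
  show "(\<lambda>\<omega>. dyadic_increments t (\<lambda>s. W s \<omega>) i) \<in> borel_measurable \<Omega>" for i
    unfolding dyadic_increments_def using assms by (intro borel_measurable_diff) auto
qed auto

text \<open>The independence clause of \<open>brownian_motion\<close> is applied to the arithmetic
  progression \<tau> k = k h. The right side mentions neither \<Omega> nor \<open>W\<close>, and the
  comparison of two Brownian motions rests on this.\<close>

lemma brownian_grid_law:
  fixes W :: "real \<Rightarrow> 'w \<Rightarrow> real^'p"
  assumes W: "brownian_motion \<Omega> W" and h: "h > 0"
  shows "distr \<Omega> (\<Pi>\<^sub>M k\<in>UNIV. borel) (\<lambda>\<omega> k. W (real (Suc k) * h) \<omega> - W (real k * h) \<omega>)
    = (\<Pi>\<^sub>M k\<in>UNIV. density lborel (\<lambda>x. ennreal (\<Prod>i\<in>UNIV. normal_density 0 (sqrt h) (x $ i))))"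
proof -
  interpret prob_space \<Omega>
    using W by (simp add: brownian_motion_def)
  have [simp]: "W s \<in> borel_measurable \<Omega>" if "s \<ge> 0" for s
    using W that by (simp add: brownian_motion_def)
  let ?X = "\<lambda>k \<omega>. W (real (Suc k) * h) \<omega> - W (real k * h) \<omega>"
  have rv: "random_variable borel (?X k)" for k
    using h by (intro borel_measurable_diff) auto
  have "0 \<le> real 0 * h \<and> strict_mono (\<lambda>k. real k * h)"
    using h by (simp add: strict_mono_def)
  moreover have "\<forall>\<tau> :: nat \<Rightarrow> real. 0 \<le> \<tau> 0 \<and> strict_mono \<tau> \<longrightarrow>
      indep_vars (\<lambda>_. borel) (\<lambda>i \<omega>. W (\<tau> (Suc i)) \<omega> - W (\<tau> i) \<omega>) UNIV"
    using W unfolding brownian_motion_def by (elim conjE)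
  ultimately have indep: "indep_vars (\<lambda>_. borel) ?X UNIV"
    by (elim allE[where x="\<lambda>k. real k * h"] impE)
  have eq: "distr \<Omega> (\<Pi>\<^sub>M k\<in>UNIV. borel) (\<lambda>\<omega>. \<lambda>k\<in>UNIV. ?X k \<omega>) = (\<Pi>\<^sub>M k\<in>UNIV. distr \<Omega> borel (?X k))"
    using indep_vars_iff_distr_eq_PiM[THEN iffD1, OF UNIV_not_empty rv indep] .
  have law: "distr \<Omega> borel (?X k) = density lborel (\<lambda>x. ennreal (\<Prod>i\<in>UNIV. normal_density 0 (sqrt h) (x $ i)))" for k
  proof -
    have k: "0 \<le> real k * h \<and> real k * h < real (Suc k) * h" "real (Suc k) * h - real k * h = h"
      using h by (simp_all add: distrib_right)
    have "\<forall>s t. 0 \<le> s \<and> s < t \<longrightarrow> distributed \<Omega> lborel (\<lambda>\<omega>. W t \<omega> - W s \<omega>)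
        (\<lambda>x. ennreal (\<Prod>i\<in>UNIV. normal_density 0 (sqrt (t - s)) (x $ i)))"
      using W unfolding brownian_motion_def by (elim conjE)
    from this[rule_format, OF k(1)]
    have "distributed \<Omega> lborel (?X k) (\<lambda>x. ennreal (\<Prod>i\<in>UNIV. normal_density 0 (sqrt h) (x $ i)))"
      unfolding k(2) .
    then have "distr \<Omega> lborel (?X k) = density lborel (\<lambda>x. ennreal (\<Prod>i\<in>UNIV. normal_density 0 (sqrt h) (x $ i)))"
      by (simp add: distributed_def)
    moreover have "distr \<Omega> borel (?X k) = distr \<Omega> lborel (?X k)"
      by (intro distr_cong) auto
    ultimately show ?thesis
      by simp
  qed
  show ?thesis
    using eq unfolding law restrict_UNIV .
qed

text \<open>Finitely many dyadic increments are sums of increments over a single, finer grid, so their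
  joint law is that of sums of independent Gaussian vectors.\<close>

lemma brownian_dyadic_law_unique:
  fixes W :: "real \<Rightarrow> 'w \<Rightarrow> real^'p" and W' :: "real \<Rightarrow> 'w' \<Rightarrow> real^'p"
  assumes W: "brownian_motion \<Omega> W" and W': "brownian_motion \<Omega>' W'" and t: "t > 0"
  shows "distr \<Omega> (\<Pi>\<^sub>M i\<in>UNIV. borel) (\<lambda>\<omega>. dyadic_increments t (\<lambda>s. W s \<omega>))
    = distr \<Omega>' (\<Pi>\<^sub>M i\<in>UNIV. borel) (\<lambda>\<omega>. dyadic_increments t (\<lambda>s. W' s \<omega>))"
    (is "?P = ?Q")
proof (rule measure_eqI_PiM_infinite)
  interpret prob_space \<Omega>
    using W by (simp add: brownian_motion_def)
  have mW: "W s \<in> borel_measurable \<Omega>" and mW': "W' s \<in> borel_measurable \<Omega>'" if "s \<ge> 0" for s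
    using W W' that by (simp_all add: brownian_motion_def)
  have meas: "(\<lambda>\<omega>. dyadic_increments t (\<lambda>s. W s \<omega>)) \<in> measurable \<Omega> (\<Pi>\<^sub>M i\<in>UNIV. borel)"
    using t by (intro measurable_dyadic_increments mW) auto
  show "finite_measure ?P"
    by (intro prob_space.finite_measure prob_space_distr meas)
  fix A :: "nat \<times> nat \<Rightarrow> (real^'p) set" and J :: "(nat \<times> nat) set"
  assume J: "finite J" "J \<subseteq> UNIV" and A: "\<And>i. i \<in> J \<Longrightarrow> A i \<in> sets borel"
  obtain N where N: "\<And>i. i \<in> J \<Longrightarrow> fst i \<le> N"
    using that[of "Max (fst ` J)"] J(1) by simp
  define h where "h = t / 2 ^ N"
  have h: "h > 0" using t by (simp add: h_def)
  \<comment> \<open>The cylinder over \<open>J\<close> expressed through level \<open>N\<close>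
    alone, where the increments are independent.\<close>
  define B where "B = {x::nat \<Rightarrow> real^'p. \<forall>i\<in>J.
      (\<Sum>j<2 ^ (N - fst i). x (snd i * 2 ^ (N - fst i) + j)) \<in> A i}"
  have "B = space (\<Pi>\<^sub>M k\<in>UNIV. borel) \<inter> (\<Inter>i\<in>J. (\<lambda>x. \<Sum>j<2 ^ (N - fst i). x (snd i * 2 ^ (N - fst i) + j)) -` A i \<inter> space (\<Pi>\<^sub>M k\<in>UNIV. borel))"
    by (auto simp: B_def space_PiM)
  also have "\<dots> \<in> sets (\<Pi>\<^sub>M k\<in>UNIV. borel)"
    using J(1) A by (cases "J = {}") (auto intro!: sets.finite_INT measurable_sets[of _ _ borel] borel_measurable_sum)
  finally have B: "B \<in> sets (\<Pi>\<^sub>M k\<in>UNIV. borel)" .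
  let ?E = "prod_emb UNIV (\<lambda>_. borel) J (Pi\<^sub>E J A)"
  have E: "?E \<in> sets (\<Pi>\<^sub>M i\<in>UNIV. borel)"
    using J A by (intro sets_PiM_I) auto
  have iff: "dyadic_increments t w \<in> ?E \<longleftrightarrow> (\<lambda>k. w (real (Suc k) * h) - w (real k * h)) \<in> B" for w :: "real \<Rightarrow> real^'p"
  proof -
    have "dyadic_increments t w \<in> ?E \<longleftrightarrow> (\<forall>i\<in>J. dyadic_increments t w i \<in> A i)"
      by (auto simp: prod_emb_def PiE_iff)
    also have "\<dots> \<longleftrightarrow> (\<forall>i\<in>J. (\<Sum>j<2 ^ (N - fst i). dyadic_increments t w (N, snd i * 2 ^ (N - fst i) + j)) \<in> A i)"
    proof (rule ball_cong[OF refl])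
      fix i assume "i \<in> J"
      from dyadic_increments_refine[OF N[OF this], of t w "snd i"]
      show "dyadic_increments t w i \<in> A i \<longleftrightarrow>
          (\<Sum>j<2 ^ (N - fst i). dyadic_increments t w (N, snd i * 2 ^ (N - fst i) + j)) \<in> A i"
        by simp
    qed
    finally show ?thesis
      by (simp add: B_def dyadic_increments_def h_def)
  qed
  let ?g = "\<lambda>V \<omega> k. V (real (Suc k) * h) \<omega> - V (real k * h) \<omega>"
  \<comment> \<open>Stated for an arbitrary space because \<Omega> and \<Omega>' have different
    types; the right side is free of \<open>M\<close> and \<open>V\<close>.\<close>
  have key: "distr M (\<Pi>\<^sub>M i\<in>UNIV. borel) (\<lambda>\<omega>. dyadic_increments t (\<lambda>s. V s \<omega>)) ?E
      = (\<Pi>\<^sub>M k\<in>UNIV. density lborel (\<lambda>x. ennreal (\<Prod>i\<in>UNIV. normal_density 0 (sqrt h) (x $ i)))) B"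
    if V: "brownian_motion M V" and mV: "\<And>s. s \<ge> 0 \<Longrightarrow> V s \<in> borel_measurable M"
    for M :: "'v measure" and V :: "real \<Rightarrow> 'v \<Rightarrow> real^'p"
  proof -
    have "distr M (\<Pi>\<^sub>M i\<in>UNIV. borel) (\<lambda>\<omega>. dyadic_increments t (\<lambda>s. V s \<omega>)) ?E
       = emeasure M ((\<lambda>\<omega>. dyadic_increments t (\<lambda>s. V s \<omega>)) -` ?E \<inter> space M)"
      using t E by (intro emeasure_distr measurable_dyadic_increments mV) auto
    also have "(\<lambda>\<omega>. dyadic_increments t (\<lambda>s. V s \<omega>)) -` ?E \<inter> space M = ?g V -` B \<inter> space M"
      using iff by auto
    also have "emeasure M \<dots> = distr M (\<Pi>\<^sub>M k\<in>UNIV. borel) (?g V) B"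
      using h B by (intro emeasure_distr[symmetric] measurable_PiM_single' borel_measurable_diff mV) auto
    finally show ?thesis
      unfolding brownian_grid_law[OF V h] .
  qed
  show "?P ?E = ?Q ?E"
    by (simp add: key[OF W mW] key[OF W' mW'])
qed auto

text \<open>Independence of the initial state from the whole path passes to measurable functions of
  the path, here the increments; the two laws are then compared on rectangles.\<close>

lemma kinetic_langevin_initial_noise_law:
  fixes W :: "real \<Rightarrow> 'w \<Rightarrow> real^'p"
  assumes kl: "kinetic_langevin \<gamma> f \<mu> \<Omega> W V L" and t: "t > 0"
  shows "distr \<Omega> (borel \<Otimes>\<^sub>M (\<Pi>\<^sub>M i\<in>UNIV. borel)) (\<lambda>\<omega>. ((V 0 \<omega>, L 0 \<omega>), dyadic_increments t (\<lambda>s. W s \<omega>)))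
    = \<mu> \<Otimes>\<^sub>M distr \<Omega> (\<Pi>\<^sub>M i\<in>UNIV. borel) (\<lambda>\<omega>. dyadic_increments t (\<lambda>s. W s \<omega>))"
proof -
  have W: "brownian_motion \<Omega> W" and \<mu>: "distr \<Omega> borel (\<lambda>\<omega>. (V 0 \<omega>, L 0 \<omega>)) = \<mu>"
    using kl by (auto simp: kinetic_langevin_def)
  interpret prob_space \<Omega>
    using W by (simp add: brownian_motion_def)
  have mW: "W s \<in> borel_measurable \<Omega>" if "s \<ge> 0" for s
    using W that by (simp add: brownian_motion_def)
  have [measurable]: "V 0 \<in> borel_measurable \<Omega>" "L 0 \<in> borel_measurable \<Omega>"
    using kl by (simp_all add: kinetic_langevin_def)
  let ?Z = "\<lambda>\<omega>. (V 0 \<omega>, L 0 \<omega>)" and ?W = "\<lambda>\<omega>. \<lambda>s\<in>{0..}. W s \<omega>"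
    and ?D = "\<lambda>\<omega>. dyadic_increments t (\<lambda>s. W s \<omega>)"
    and ?P = "\<Pi>\<^sub>M i\<in>(UNIV :: (nat \<times> nat) set). (borel :: (real^'p) measure)"
  have Z: "?Z \<in> borel_measurable \<Omega>"
    by measurable
  have D: "?D \<in> measurable \<Omega> ?P"
    using t by (intro measurable_dyadic_increments mW) auto
  have Wm: "?W \<in> measurable \<Omega> (\<Pi>\<^sub>M s\<in>{0..}. borel)"
    by (intro measurable_restrict mW) auto
  have T: "dyadic_increments t \<in> measurable (\<Pi>\<^sub>M s\<in>{0..}. borel) ?P"
    using t by (intro measurable_dyadic_increments[where W="\<lambda>s w. w s"]) auto
  interpret \<mu>: prob_space \<mu>
    unfolding \<mu>[symmetric] by (rule prob_space_distr[OF Z])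
  interpret D: prob_space "distr \<Omega> ?P ?D"
    by (rule prob_space_distr[OF D])
  show ?thesis
  proof (rule pair_measure_eqI[symmetric])
    show "sets (\<mu> \<Otimes>\<^sub>M distr \<Omega> ?P ?D) = sets (distr \<Omega> (borel \<Otimes>\<^sub>M ?P) (\<lambda>\<omega>. (?Z \<omega>, ?D \<omega>)))"
      unfolding \<mu>[symmetric] by (auto intro: sets_pair_measure_cong)
    fix A B
    assume "A \<in> sets \<mu>" and "B \<in> sets (distr \<Omega> ?P ?D)"
    then have A: "A \<in> sets borel" and B: "B \<in> sets ?P"
      by (auto simp flip: \<mu>)
    let ?a = "?Z -` A \<inter> space \<Omega>" and ?b = "?D -` B \<inter> space \<Omega>"
    have a: "?a \<in> sets (vimage_algebra (space \<Omega>) ?Z borel)"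
      using A by (rule in_vimage_algebra)
    \<comment> \<open>This places the event in the sigma-algebra generated by the restricted path,
      about which the independence clause speaks.\<close>
    have "?b = ?W -` (dyadic_increments t -` B \<inter> space (\<Pi>\<^sub>M s\<in>{0..}. borel)) \<inter> space \<Omega>"
      using t measurable_space[OF Wm] by (auto simp: dyadic_increments_restrict)
    also have "\<dots> \<in> sets (vimage_algebra (space \<Omega>) ?W (\<Pi>\<^sub>M s\<in>{0..}. borel))"
      by (intro in_vimage_algebra measurable_sets[OF T B])
    finally have b: "?b \<in> sets (vimage_algebra (space \<Omega>) ?W (\<Pi>\<^sub>M s\<in>{0..}. borel))" .
    have "emeasure \<mu> A * emeasure (distr \<Omega> ?P ?D) B = emeasure \<Omega> ?a * emeasure \<Omega> ?b"
      using A B by (simp add: emeasure_distr[OF D] emeasure_distr[OF Z] flip: \<mu>)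
    also have "\<dots> = emeasure \<Omega> (?a \<inter> ?b)"
      using kl indep_setD[OF _ a b]
      by (simp add: kinetic_langevin_def emeasure_eq_measure ennreal_mult)
    also have "?a \<inter> ?b = (\<lambda>\<omega>. (?Z \<omega>, ?D \<omega>)) -` (A \<times> B) \<inter> space \<Omega>"
      by auto
    also have "emeasure \<Omega> \<dots> = emeasure (distr \<Omega> (borel \<Otimes>\<^sub>M ?P) (\<lambda>\<omega>. (?Z \<omega>, ?D \<omega>))) (A \<times> B)"
      using A B Z D by (intro emeasure_distr[symmetric] measurable_Pair) auto
    finally show "emeasure \<mu> A * emeasure (distr \<Omega> ?P ?D) B
      = emeasure (distr \<Omega> (borel \<Otimes>\<^sub>M ?P) (\<lambda>\<omega>. (?Z \<omega>, ?D \<omega>))) (A \<times> B)" .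
  qed unfold_locales
qed

subsection \<open>Wasserstein distance and coupling\<close>

lemma ennreal_sqrt_mono: "x \<le> y \<Longrightarrow> ennreal_sqrt x \<le> ennreal_sqrt y"
  by (auto simp: ennreal_sqrt_def top_unique enn2real_mono top.not_eq_extremum intro!: ennreal_leI real_sqrt_le_mono)

lemma ennreal_sqrt_mult_square:
  assumes "c > 0"
  shows "ennreal_sqrt (ennreal (c\<^sup>2) * x) = ennreal c * ennreal_sqrt x"
proof (cases x)
  case (real r)
  then show ?thesis
    using assms by (simp add: ennreal_sqrt_def real_sqrt_mult flip: ennreal_mult)
next
  case top
  then show ?thesis
    using assms by (simp add: ennreal_sqrt_def ennreal_mult_top)
qed

text \<open>Each coupling bounds the target infimum divided by c^2, so the bound passes to the
  infimum over couplings without an optimal one. Since c^2 is positive and finite, the division can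
  be undone in \<open>ennreal\<close> even when the values are infinite.\<close>

lemma W2_le_by_couplings:
  fixes \<mu> \<nu> :: "'a::{metric_space, second_countable_topology} measure"
    and \<mu>' \<nu>' :: "'b::{metric_space, second_countable_topology} measure"
  assumes c: "c > 0"
    and coup: "\<And>\<pi>. \<pi> \<in> couplings \<mu> \<nu> \<Longrightarrow> \<exists>\<pi>'\<in>couplings \<mu>' \<nu>'.
      (\<integral>\<^sup>+z. ennreal ((dist (fst z) (snd z))\<^sup>2) \<partial>\<pi>')
        \<le> ennreal (c\<^sup>2) * (\<integral>\<^sup>+z. ennreal ((dist (fst z) (snd z))\<^sup>2) \<partial>\<pi>)"
  shows "W2 \<mu>' \<nu>' \<le> ennreal c * W2 \<mu> \<nu>"
proof -
  let ?C = "\<lambda>\<pi>. \<integral>\<^sup>+z. ennreal ((dist (fst z) (snd z))\<^sup>2) \<partial>\<pi>"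
    and ?C' = "\<lambda>\<pi>. \<integral>\<^sup>+z. ennreal ((dist (fst z) (snd z))\<^sup>2) \<partial>\<pi>"
  let ?I = "INF \<pi>\<in>couplings \<mu> \<nu>. ?C \<pi>" and ?I' = "INF \<pi>\<in>couplings \<mu>' \<nu>'. ?C' \<pi>"
  have c2: "ennreal (c\<^sup>2) > 0"
    using c by simp
  have "?I' / ennreal (c\<^sup>2) \<le> ?I"
  proof (rule INF_greatest)
    fix \<pi> assume "\<pi> \<in> couplings \<mu> \<nu>"
    from coup[OF this] obtain \<pi>' where "\<pi>' \<in> couplings \<mu>' \<nu>'" "?C' \<pi>' \<le> ennreal (c\<^sup>2) * ?C \<pi>"
      by blast
    then show "?I' / ennreal (c\<^sup>2) \<le> ?C \<pi>"
      by (intro divide_le_posI_ennreal c2 INF_lower2)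
  qed
  then have "ennreal (c\<^sup>2) * (?I' / ennreal (c\<^sup>2)) \<le> ennreal (c\<^sup>2) * ?I"
    by (rule mult_left_mono) simp
  also have "ennreal (c\<^sup>2) * (?I' / ennreal (c\<^sup>2)) = ?I'"
    using c2 unfolding ennreal_times_divide mult.commute[of "ennreal (c\<^sup>2)"]
    by (intro ennreal_mult_divide_eq) auto
  finally have "ennreal_sqrt ?I' \<le> ennreal_sqrt (ennreal (c\<^sup>2) * ?I)"
    by (rule ennreal_sqrt_mono)
  then show ?thesis
    unfolding W2_def ennreal_sqrt_mult_square[OF c] .
qed

lemma distr_pair_snd:
  assumes "prob_space M" "prob_space N"
  shows "distr (M \<Otimes>\<^sub>M N) N snd = N"
proof (rule measure_eqI)
  interpret M: prob_space M by fact
  interpret N: prob_space N by fact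
  fix A assume "A \<in> sets (distr (M \<Otimes>\<^sub>M N) N snd)"
  then have A: "A \<in> sets N" by simp
  then have "snd -` A \<inter> space (M \<Otimes>\<^sub>M N) = space M \<times> A"
    using sets.sets_into_space[OF A] by (auto simp: space_pair_measure)
  then show "emeasure (distr (M \<Otimes>\<^sub>M N) N snd) A = emeasure N A"
    using A by (simp add: emeasure_distr N.emeasure_pair_measure_Times M.emeasure_space_1)
qed simp

section \<open>The Euler map on initial states and noise, and its limit\<close>

lemma borel_measurable_euler_scheme:
  fixes b :: "'a::euclidean_space \<Rightarrow> 'a"
  assumes [measurable]: "b \<in> borel_measurable borel" "\<And>k. (\<lambda>x. \<xi> x k) \<in> borel_measurable M"
    "z \<in> borel_measurable M"
  shows "(\<lambda>x. euler_scheme b h (\<xi> x) (z x) k) \<in> borel_measurable M"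
  by (induction k) simp_all

text \<open>No probability space occurs here, so both solutions are approximated by one and the same
  function. The noise enters the velocity only.\<close>

definition langevin_euler ::
  "real \<Rightarrow> real \<Rightarrow> ('a::real_vector \<Rightarrow> 'a) \<Rightarrow> nat \<Rightarrow> ('a \<times> 'a) \<times> (nat \<times> nat \<Rightarrow> 'a) \<Rightarrow> 'a" where
  "langevin_euler t \<gamma> g n x = snd (euler_scheme (langevin_drift \<gamma> g) (t / 2 ^ n)
     (\<lambda>k. (sqrt (2 * \<gamma>) *\<^sub>R snd x (n, k), 0)) (fst x) (2 ^ n))"

lemma borel_measurable_langevin_euler:
  fixes g :: "real^'p \<Rightarrow> real^'p"
  assumes g: "continuous_on UNIV g"
  shows "langevin_euler t \<gamma> g n \<in> borel_measurable (borel \<Otimes>\<^sub>M (\<Pi>\<^sub>M i\<in>UNIV. borel))"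
proof -
  have "continuous_on UNIV (langevin_drift \<gamma> g)"
    unfolding langevin_drift_def
    by (intro continuous_intros continuous_on_compose2[OF g]) auto
  then have drift: "langevin_drift \<gamma> g \<in> borel_measurable borel"
    by (rule borel_measurable_continuous_onI)
  have noise: "(\<lambda>x. (sqrt (2 * \<gamma>) *\<^sub>R snd x (n, k), 0 :: real^'p)) \<in> borel_measurable
      ((borel :: ((real^'p) \<times> (real^'p)) measure) \<Otimes>\<^sub>M (\<Pi>\<^sub>M i\<in>UNIV. (borel :: (real^'p) measure)))" for k
    by (intro borel_measurable_Pair borel_measurable_scaleR
        measurable_compose[OF measurable_snd measurable_component_singleton]) auto
  have snd: "snd \<in> borel_measurable (borel :: ((real^'p) \<times> (real^'p)) measure)"
    by (intro borel_measurable_continuous_onI continuous_intros)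
  show ?thesis
    unfolding langevin_euler_def[abs_def]
    by (rule measurable_compose[OF borel_measurable_euler_scheme[OF drift noise measurable_fst] snd])
qed

text \<open>With Z = (V, L) and N = (sqrt (2 \<gamma>) W, 0), almost every path satisfies Z = Z 0 +
  (integral of the drift along Z) + N, and the deterministic convergence applies to that
  path.\<close>

lemma kinetic_langevin_euler_tendsto:
  fixes f :: "real^'p \<Rightarrow> real"
  assumes kl: "kinetic_langevin \<gamma> f \<mu> \<Omega> W V L" and \<gamma>: "\<gamma> > 0" and t: "t > 0"
    and B: "B \<ge> 0" and lip: "\<And>x y. norm (grad f x - grad f y) \<le> B * norm (x - y)"
  shows "AE \<omega> in \<Omega>. (\<lambda>n. langevin_euler t \<gamma> (grad f) n
      ((V 0 \<omega>, L 0 \<omega>), dyadic_increments t (\<lambda>s. W s \<omega>))) \<longlonglongrightarrow> L t \<omega>"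
proof -
  let ?b = "langevin_drift \<gamma> (grad f)" and ?c = "sqrt (2 * \<gamma>)"
  have b_lip: "norm (?b z - ?b z') \<le> (1 + \<gamma> + B) * norm (z - z')" for z z'
    using \<gamma> B lip by (intro langevin_drift_lipschitz) auto
  have b_cont: "continuous_on UNIV ?b"
    using \<gamma> B b_lip
    by (intro lipschitz_on_continuous_on[of "1 + \<gamma> + B"] lipschitz_onI) (auto simp: dist_norm)
  have "AE \<omega> in \<Omega>.
        continuous_on {0..} (\<lambda>t. V t \<omega>) \<and> continuous_on {0..} (\<lambda>t. L t \<omega>) \<and>
        (\<forall>t\<ge>0.
           V t \<omega> = V 0 \<omega> - integral {0..t} (\<lambda>s. \<gamma> *\<^sub>R V s \<omega> + grad f (L s \<omega>))
                    + sqrt (2 * \<gamma>) *\<^sub>R W t \<omega> \<and>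
           L t \<omega> = L 0 \<omega> + integral {0..t} (\<lambda>s. V s \<omega>))"
    by (rule kl[unfolded kinetic_langevin_def, THEN conjunct2, THEN conjunct2, THEN conjunct2,
          THEN conjunct2, THEN conjunct2])
  then show ?thesis
  proof (rule AE_mp, intro AE_I2 impI, elim conjE)
    fix \<omega>
    assume cV: "continuous_on {0..} (\<lambda>t. V t \<omega>)" and cL: "continuous_on {0..} (\<lambda>t. L t \<omega>)"
      and eq: "\<forall>t\<ge>0.
           V t \<omega> = V 0 \<omega> - integral {0..t} (\<lambda>s. \<gamma> *\<^sub>R V s \<omega> + grad f (L s \<omega>))
                    + sqrt (2 * \<gamma>) *\<^sub>R W t \<omega> \<and>
           L t \<omega> = L 0 \<omega> + integral {0..t} (\<lambda>s. V s \<omega>)"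
    define Z where "Z s = (V s \<omega>, L s \<omega>)" for s
    define N where "N s = (?c *\<^sub>R W s \<omega>, 0 :: real^'p)" for s
    have Z: "continuous_on {0..s} Z" for s
      unfolding Z_def by (intro continuous_on_Pair continuous_on_subset[OF cV] continuous_on_subset[OF cL]) auto
    have int: "(\<lambda>r. ?b (Z r)) integrable_on {0..s}" for s
      by (intro integrable_continuous_real continuous_on_compose2[OF b_cont Z]) auto
    have Z_eq: "Z s = Z 0 + integral {0..s} (\<lambda>r. ?b (Z r)) + N s" if "s \<in> {0..t}" for s
    proof -
      have 1: "fst (integral {0..s} (\<lambda>r. ?b (Z r))) = - integral {0..s} (\<lambda>r. \<gamma> *\<^sub>R V r \<omega> + grad f (L r \<omega>))"
        using integral_linear[OF int bounded_linear_fst, of s]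
        by (simp add: comp_def langevin_drift_def Z_def del: minus_add_distrib)
      have 2: "snd (integral {0..s} (\<lambda>r. ?b (Z r))) = integral {0..s} (\<lambda>r. V r \<omega>)"
        using integral_linear[OF int bounded_linear_snd, of s]
        by (simp add: comp_def langevin_drift_def Z_def)
      have s: "V s \<omega> = V 0 \<omega> - integral {0..s} (\<lambda>s. \<gamma> *\<^sub>R V s \<omega> + grad f (L s \<omega>)) + ?c *\<^sub>R W s \<omega>"
        "L s \<omega> = L 0 \<omega> + integral {0..s} (\<lambda>s. V s \<omega>)"
      proof -
        have "0 \<le> s"
          using that by simp
        note eq[rule_format, OF this]
        then show "V s \<omega> = V 0 \<omega> - integral {0..s} (\<lambda>s. \<gamma> *\<^sub>R V s \<omega> + grad f (L s \<omega>)) + ?c *\<^sub>R W s \<omega>"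
          "L s \<omega> = L 0 \<omega> + integral {0..s} (\<lambda>s. V s \<omega>)"
          by (rule conjunct1, rule conjunct2)
      qed
      show ?thesis
      proof (rule prod_eqI)
        show "fst (Z s) = fst (Z 0 + integral {0..s} (\<lambda>r. ?b (Z r)) + N s)"
          unfolding fst_add 1 using s(1) by (simp add: Z_def N_def)
        show "snd (Z s) = snd (Z 0 + integral {0..s} (\<lambda>r. ?b (Z r)) + N s)"
          unfolding snd_add 2 using s(2) by (simp add: Z_def N_def)
      qed
    qed
    have "(\<lambda>n. euler_scheme ?b (t / 2^n)
            (\<lambda>k. N (real (Suc k) * (t / 2^n)) - N (real k * (t / 2^n))) (Z 0) (2^n)) \<longlonglongrightarrow> Z t"
      by (rule euler_scheme_tendsto[OF _ b_lip t Z Z_eq]) (use \<gamma> B in simp)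
    from tendsto_snd[OF this] have "(\<lambda>n. snd (euler_scheme ?b (t / 2^n)
            (\<lambda>k. N (real (Suc k) * (t / 2^n)) - N (real k * (t / 2^n))) (Z 0) (2^n))) \<longlonglongrightarrow> L t \<omega>"
      by (simp only: Z_def snd_conv)
    then show "(\<lambda>n. langevin_euler t \<gamma> (grad f) n
      ((V 0 \<omega>, L 0 \<omega>), dyadic_increments t (\<lambda>s. W s \<omega>))) \<longlonglongrightarrow> L t \<omega>"
      by (simp only: langevin_euler_def dyadic_increments_def Z_def N_def fst_conv snd_conv
          diff_Pair scaleR_diff_right diff_self)
  qed
qed

text \<open>\<open>lim\<close> is total and carries no information where the sequence diverges.
  Hence the second claim: the contraction can be passed to the limit only where both sequences
  converge.\<close>

lemma kinetic_langevin_law: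
  fixes f :: "real^'p \<Rightarrow> real"
  assumes kl: "kinetic_langevin \<gamma> f \<mu> \<Omega> W V L" and \<gamma>: "\<gamma> > 0" and t: "t > 0"
    and B: "B \<ge> 0" and lip: "\<And>x y. norm (grad f x - grad f y) \<le> B * norm (x - y)"
  defines "\<rho> \<equiv> distr \<Omega> (\<Pi>\<^sub>M i\<in>UNIV. borel) (\<lambda>\<omega>. dyadic_increments t (\<lambda>s. W s \<omega>))"
  shows "distr (\<mu> \<Otimes>\<^sub>M \<rho>) borel (\<lambda>x. lim (\<lambda>n. langevin_euler t \<gamma> (grad f) n x)) = distr \<Omega> borel (L t)"
    and "AE x in \<mu> \<Otimes>\<^sub>M \<rho>. convergent (\<lambda>n. langevin_euler t \<gamma> (grad f) n x)"
proof -
  let ?P = "\<Pi>\<^sub>M i\<in>(UNIV :: (nat \<times> nat) set). (borel :: (real^'p) measure)"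
  let ?E = "\<lambda>n. langevin_euler t \<gamma> (grad f) n"
  let ?X = "\<lambda>\<omega>. ((V 0 \<omega>, L 0 \<omega>), dyadic_increments t (\<lambda>s. W s \<omega>))"
  have W: "brownian_motion \<Omega> W"
    and VL: "\<forall>t\<ge>0. V t \<in> borel_measurable \<Omega> \<and> L t \<in> borel_measurable \<Omega>"
    by (rule kl[unfolded kinetic_langevin_def, THEN conjunct1],
        rule kl[unfolded kinetic_langevin_def, THEN conjunct2, THEN conjunct1])
  have mW: "\<forall>t\<ge>0. W t \<in> borel_measurable \<Omega>"
    using W unfolding brownian_motion_def by (elim conjE)
  have D: "(\<lambda>\<omega>. dyadic_increments t (\<lambda>s. W s \<omega>)) \<in> measurable \<Omega> ?P"
    using t mW by (intro measurable_dyadic_increments) auto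
  have X: "?X \<in> measurable \<Omega> (borel \<Otimes>\<^sub>M ?P)"
    using VL by (intro measurable_Pair borel_measurable_Pair D) auto
  have law: "\<mu> \<Otimes>\<^sub>M \<rho> = distr \<Omega> (borel \<Otimes>\<^sub>M ?P) ?X"
    unfolding \<rho>_def by (rule kinetic_langevin_initial_noise_law[OF kl t, symmetric])
  have "continuous_on UNIV (grad f)"
    using B lip by (intro lipschitz_on_continuous_on[of B] lipschitz_onI) (auto simp: dist_norm)
  then have E[measurable]: "?E n \<in> borel_measurable (borel \<Otimes>\<^sub>M ?P)" for n
    by (rule borel_measurable_langevin_euler)
  have lim_meas: "(\<lambda>x. lim (\<lambda>n. ?E n x)) \<in> borel_measurable (borel \<Otimes>\<^sub>M ?P)"
    by (rule borel_measurable_lim_metric[OF E])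
  have conv: "AE \<omega> in \<Omega>. (\<lambda>n. ?E n (?X \<omega>)) \<longlonglongrightarrow> L t \<omega>"
    by (rule kinetic_langevin_euler_tendsto[OF kl \<gamma> t B lip])
  have "distr (\<mu> \<Otimes>\<^sub>M \<rho>) borel (\<lambda>x. lim (\<lambda>n. ?E n x)) = distr \<Omega> borel (\<lambda>\<omega>. lim (\<lambda>n. ?E n (?X \<omega>)))"
    unfolding law by (subst distr_distr[OF lim_meas X]) (simp add: comp_def)
  also have "\<dots> = distr \<Omega> borel (L t)"
  proof (rule distr_cong_AE)
    show "AE \<omega> in \<Omega>. lim (\<lambda>n. ?E n (?X \<omega>)) = L t \<omega>"
      using conv by (rule eventually_mono) (rule limI)
    show "(\<lambda>\<omega>. lim (\<lambda>n. ?E n (?X \<omega>))) \<in> borel_measurable \<Omega>"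
      using measurable_comp[OF X lim_meas] by (simp add: comp_def)
  qed (use VL t in auto)
  finally show "distr (\<mu> \<Otimes>\<^sub>M \<rho>) borel (\<lambda>x. lim (\<lambda>n. ?E n x)) = distr \<Omega> borel (L t)" .
  \<comment> \<open>Convergence is rewritten as a Cauchy condition, whose set is measurable; this is
    what carries the almost sure statement from \<Omega> to the image measure.\<close>
  have conv_sets: "{x \<in> space (borel \<Otimes>\<^sub>M ?P). convergent (\<lambda>n. ?E n x)} \<in> sets (borel \<Otimes>\<^sub>M ?P)"
    unfolding Cauchy_convergent_iff[symmetric] by (rule sets_Collect_Cauchy[OF E])
  have "AE \<omega> in \<Omega>. convergent (\<lambda>n. ?E n (?X \<omega>))"
    using conv by (rule eventually_mono) (rule convergentI)
  then show "AE x in \<mu> \<Otimes>\<^sub>M \<rho>. convergent (\<lambda>n. ?E n x)"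
    unfolding law AE_distr_iff[OF X conv_sets] .
qed

section \<open>Coupling with a shared velocity and shared noise\<close>

lemma borel_measurable_dist_square:
  fixes M :: "('a::{second_countable_topology, metric_space} \<times> 'a) measure"
  assumes "sets M = sets (borel \<Otimes>\<^sub>M borel)"
  shows "(\<lambda>z. ennreal ((dist (fst z) (snd z))\<^sup>2)) \<in> borel_measurable M"
proof -
  have "fst \<in> borel_measurable M" "snd \<in> borel_measurable M"
    unfolding measurable_cong_sets[OF assms refl] by (rule measurable_fst, rule measurable_snd)
  then show ?thesis
    by (intro measurable_compose[OF _ measurable_ennreal] borel_measurable_power borel_measurable_dist)
qed

text \<open>Given a coupling of the initial laws, keep only the coupling it induces on the positions and draw
  a common velocity and a common noise independently of it.\<close>

lemma shared_noise_coupling: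
  fixes \<mu>1 :: "'a::{second_countable_topology, metric_space} measure"
    and \<mu>2 \<mu>2' :: "'b::{second_countable_topology, metric_space} measure"
    and F :: "('a \<times> 'b) \<times> 'c \<Rightarrow> 'd::{second_countable_topology, metric_space}"
  assumes [simp]: "sets \<mu>1 = sets borel" "sets \<mu>2 = sets borel" "sets \<mu>2' = sets borel"
    and prob: "prob_space \<mu>1" "prob_space \<mu>2" "prob_space \<mu>2'" "prob_space \<rho>"
    and F: "F \<in> borel_measurable ((borel \<Otimes>\<^sub>M borel) \<Otimes>\<^sub>M \<rho>)"
    and \<pi>: "\<pi> \<in> couplings (\<mu>1 \<Otimes>\<^sub>M \<mu>2) (\<mu>1 \<Otimes>\<^sub>M \<mu>2')"
    and good: "AE x in (\<mu>1 \<Otimes>\<^sub>M \<mu>2) \<Otimes>\<^sub>M \<rho>. good x" "AE x in (\<mu>1 \<Otimes>\<^sub>M \<mu>2') \<Otimes>\<^sub>M \<rho>. good x"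
    and contr: "\<And>v l l' d. good ((v, l), d) \<Longrightarrow> good ((v, l'), d) \<Longrightarrow>
      (dist (F ((v, l), d)) (F ((v, l'), d)))\<^sup>2 \<le> K * (dist l l')\<^sup>2"
    and K: "K \<ge> 0"
  shows "\<exists>\<pi>'\<in>couplings (distr ((\<mu>1 \<Otimes>\<^sub>M \<mu>2) \<Otimes>\<^sub>M \<rho>) borel F) (distr ((\<mu>1 \<Otimes>\<^sub>M \<mu>2') \<Otimes>\<^sub>M \<rho>) borel F).
      (\<integral>\<^sup>+z. ennreal ((dist (fst z) (snd z))\<^sup>2) \<partial>\<pi>')
        \<le> ennreal K * (\<integral>\<^sup>+z. ennreal ((dist (fst z) (snd z))\<^sup>2) \<partial>\<pi>)"
proof -
  interpret \<mu>1: prob_space \<mu>1 by fact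
  interpret \<mu>2: prob_space \<mu>2 by fact
  interpret \<mu>2': prob_space \<mu>2' by fact
  interpret \<rho>: prob_space \<rho> by fact
  have fst_\<pi>: "distr \<pi> (\<mu>1 \<Otimes>\<^sub>M \<mu>2) fst = \<mu>1 \<Otimes>\<^sub>M \<mu>2"
    and snd_\<pi>: "distr \<pi> (\<mu>1 \<Otimes>\<^sub>M \<mu>2') snd = \<mu>1 \<Otimes>\<^sub>M \<mu>2'"
    and "sets \<pi> = sets ((\<mu>1 \<Otimes>\<^sub>M \<mu>2) \<Otimes>\<^sub>M (\<mu>1 \<Otimes>\<^sub>M \<mu>2'))"
    using \<pi> unfolding couplings_def by blast+
  moreover have sets12: "sets (\<mu>1 \<Otimes>\<^sub>M \<mu>2) = sets (borel \<Otimes>\<^sub>M borel)" "sets (\<mu>1 \<Otimes>\<^sub>M \<mu>2') = sets (borel \<Otimes>\<^sub>M borel)"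
    using assms(1-3) by (auto intro!: sets_pair_measure_cong)
  ultimately have sets_\<pi>: "sets \<pi> = sets ((borel \<Otimes>\<^sub>M borel) \<Otimes>\<^sub>M (borel \<Otimes>\<^sub>M borel))"
    using sets_pair_measure_cong[OF sets12] by (simp only:)
  have [measurable]: "fst \<in> measurable \<pi> (borel \<Otimes>\<^sub>M borel)" "snd \<in> measurable \<pi> (borel \<Otimes>\<^sub>M borel)"
    unfolding measurable_cong_sets[OF sets_\<pi> refl] by (rule measurable_fst, rule measurable_snd)
  have fst_meas: "fst \<in> measurable \<pi> (\<mu>1 \<Otimes>\<^sub>M \<mu>2)" and snd_meas: "snd \<in> measurable \<pi> (\<mu>1 \<Otimes>\<^sub>M \<mu>2')"
    unfolding measurable_cong_sets[OF sets_\<pi> sets12(1)] measurable_cong_sets[OF sets_\<pi> sets12(2)]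
    by (rule measurable_fst, rule measurable_snd)
  \<comment> \<open>\<pi> has total mass 1 because its first marginal does.\<close>
  have "prob_space (distr \<pi> (\<mu>1 \<Otimes>\<^sub>M \<mu>2) fst)"
    unfolding fst_\<pi> by (rule prob_space_pair) fact+
  then interpret \<pi>: prob_space \<pi>
    by (rule prob_space_distrD[OF fst_meas])
  \<comment> \<open>The joint law of the two positions under \<pi>.\<close>
  define \<pi>2 where "\<pi>2 = distr \<pi> (borel \<Otimes>\<^sub>M borel) (\<lambda>z. (snd (fst z), snd (snd z)))"
  have p[measurable]: "(\<lambda>z. (snd (fst z), snd (snd z))) \<in> measurable \<pi> (borel \<Otimes>\<^sub>M borel)"
    by measurable
  interpret \<pi>2: prob_space \<pi>2
    unfolding \<pi>2_def by (rule \<pi>.prob_space_distr[OF p])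
  have s2: "sets \<pi>2 = sets (borel \<Otimes>\<^sub>M borel)"
    by (simp add: \<pi>2_def)
  have fst_\<pi>2: "distr \<pi>2 borel fst = \<mu>2"
  proof -
    have "distr \<pi>2 borel fst = distr \<pi> borel (\<lambda>z. snd (fst z))"
      unfolding \<pi>2_def by (subst distr_distr) (auto simp: comp_def)
    also have "\<dots> = distr (distr \<pi> (\<mu>1 \<Otimes>\<^sub>M \<mu>2) fst) borel snd"
      by (subst distr_distr[OF _ fst_meas]) (auto simp: comp_def measurable_cong_sets[OF sets12(1) refl])
    also have "\<dots> = distr (\<mu>1 \<Otimes>\<^sub>M \<mu>2) \<mu>2 snd"
      unfolding fst_\<pi> by (intro distr_cong) auto
    finally show ?thesis
      using distr_pair_snd[OF prob(1,2)] by simp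
  qed
  have snd_\<pi>2: "distr \<pi>2 borel snd = \<mu>2'"
  proof -
    have "distr \<pi>2 borel snd = distr \<pi> borel (\<lambda>z. snd (snd z))"
      unfolding \<pi>2_def by (subst distr_distr) (auto simp: comp_def)
    also have "\<dots> = distr (distr \<pi> (\<mu>1 \<Otimes>\<^sub>M \<mu>2') snd) borel snd"
      by (subst distr_distr[OF _ snd_meas]) (auto simp: comp_def measurable_cong_sets[OF sets12(2) refl])
    also have "\<dots> = distr (\<mu>1 \<Otimes>\<^sub>M \<mu>2') \<mu>2' snd"
      unfolding snd_\<pi> by (intro distr_cong) auto
    finally show ?thesis
      using distr_pair_snd[OF prob(1,3)] by simp
  qed
  define R where "R = (\<mu>1 \<Otimes>\<^sub>M \<pi>2) \<Otimes>\<^sub>M \<rho>"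
  \<comment> \<open>With \<open>h\<close> equal to \<open>fst\<close> or \<open>snd\<close>, this
    pairs the shared velocity with one of the two positions and keeps the noise. The two choices
    produce the inputs of the two solutions from one sample of \<open>R\<close>.\<close>
  define \<phi> where "\<phi> h x = ((fst (fst x), h (snd (fst x))), snd x)" for h :: "'b \<times> 'b \<Rightarrow> 'b" and x :: "('a \<times> 'b \<times> 'b) \<times> 'c"
  have \<phi>_meas: "\<phi> h \<in> measurable R ((borel \<Otimes>\<^sub>M borel) \<Otimes>\<^sub>M \<rho>)"
    and \<phi>_law: "distr R ((borel \<Otimes>\<^sub>M borel) \<Otimes>\<^sub>M \<rho>) (\<phi> h) = (\<mu>1 \<Otimes>\<^sub>M distr \<pi>2 borel h) \<Otimes>\<^sub>M \<rho>"
    if h: "h \<in> borel_measurable (borel \<Otimes>\<^sub>M borel)" for h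
  proof -
    have h': "h \<in> borel_measurable \<pi>2"
      using h by (simp add: measurable_cong_sets[OF s2 refl])
    interpret h: prob_space "distr \<pi>2 borel h"
      by (rule \<pi>2.prob_space_distr[OF h'])
    have id1: "distr \<mu>1 borel (\<lambda>x. x) = \<mu>1" and id\<rho>: "distr \<rho> \<rho> (\<lambda>x. x) = \<rho>"
      by (simp_all add: distr_id2)
    have m1: "(\<lambda>x. x) \<in> measurable \<mu>1 borel"
      by (simp add: measurable_ident_sets)
    have "distr \<mu>1 borel (\<lambda>x. x) \<Otimes>\<^sub>M distr \<pi>2 borel h
        = distr (\<mu>1 \<Otimes>\<^sub>M \<pi>2) (borel \<Otimes>\<^sub>M borel) (\<lambda>(x, y). (x, h y))"
      by (rule pair_measure_distr[OF m1 h']) unfold_locales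
    then have 1: "distr (\<mu>1 \<Otimes>\<^sub>M \<pi>2) (borel \<Otimes>\<^sub>M borel) (\<lambda>(x, y). (x, h y)) = \<mu>1 \<Otimes>\<^sub>M distr \<pi>2 borel h"
      unfolding id1 by simp
    have m2: "(\<lambda>(x, y). (x, h y)) \<in> measurable (\<mu>1 \<Otimes>\<^sub>M \<pi>2) (borel \<Otimes>\<^sub>M borel)"
      unfolding case_prod_beta
      by (intro measurable_Pair measurable_compose[OF measurable_fst m1] measurable_compose[OF measurable_snd h'])
    have "distr (\<mu>1 \<Otimes>\<^sub>M \<pi>2) (borel \<Otimes>\<^sub>M borel) (\<lambda>(x, y). (x, h y)) \<Otimes>\<^sub>M distr \<rho> \<rho> (\<lambda>x. x)
        = distr R ((borel \<Otimes>\<^sub>M borel) \<Otimes>\<^sub>M \<rho>) (\<lambda>(x, y). ((\<lambda>(x, y). (x, h y)) x, y))"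
      unfolding R_def by (rule pair_measure_distr[OF m2 measurable_ident_sets[OF refl]])
        (unfold id\<rho>, unfold_locales)
    moreover have \<phi>_eq: "\<phi> h = (\<lambda>(x, y). ((\<lambda>(x, y). (x, h y)) x, y))"
      by (auto simp: \<phi>_def)
    ultimately show "distr R ((borel \<Otimes>\<^sub>M borel) \<Otimes>\<^sub>M \<rho>) (\<phi> h) = (\<mu>1 \<Otimes>\<^sub>M distr \<pi>2 borel h) \<Otimes>\<^sub>M \<rho>"
      unfolding 1 id\<rho> by simp
    show "\<phi> h \<in> measurable R ((borel \<Otimes>\<^sub>M borel) \<Otimes>\<^sub>M \<rho>)"
      unfolding \<phi>_def[abs_def] R_def
      by (intro measurable_Pair measurable_compose[OF measurable_fst measurable_compose[OF measurable_fst m1]]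
          measurable_compose[OF measurable_fst measurable_compose[OF measurable_snd h']] measurable_snd)
  qed
  have f: "fst \<in> borel_measurable (borel \<Otimes>\<^sub>M borel)" and s: "snd \<in> borel_measurable (borel \<Otimes>\<^sub>M borel)"
    by (rule measurable_fst, rule measurable_snd)
  define G where "G x = (F (\<phi> fst x), F (\<phi> snd x))" for x
  have Gf: "(\<lambda>x. F (\<phi> fst x)) \<in> borel_measurable R" and Gs: "(\<lambda>x. F (\<phi> snd x)) \<in> borel_measurable R"
    by (rule measurable_compose[OF \<phi>_meas[OF f] F], rule measurable_compose[OF \<phi>_meas[OF s] F])
  have G: "G \<in> measurable R (borel \<Otimes>\<^sub>M borel)"
    unfolding G_def by (intro measurable_Pair Gf Gs)
  let ?\<nu> = "distr ((\<mu>1 \<Otimes>\<^sub>M \<mu>2) \<Otimes>\<^sub>M \<rho>) borel F" and ?\<nu>' = "distr ((\<mu>1 \<Otimes>\<^sub>M \<mu>2') \<Otimes>\<^sub>M \<rho>) borel F"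
  define \<pi>' where "\<pi>' = distr R (borel \<Otimes>\<^sub>M borel) G"
  have "\<pi>' \<in> couplings ?\<nu> ?\<nu>'"
  proof -
    have "distr \<pi>' ?\<nu> fst = distr \<pi>' borel fst"
      by (intro distr_cong) auto
    also have "\<dots> = distr R borel (\<lambda>x. F (\<phi> fst x))"
      unfolding \<pi>'_def by (subst distr_distr[OF f G]) (simp add: comp_def G_def)
    also have "\<dots> = distr (distr R ((borel \<Otimes>\<^sub>M borel) \<Otimes>\<^sub>M \<rho>) (\<phi> fst)) borel F"
      by (subst distr_distr[OF F \<phi>_meas[OF f]]) (simp add: comp_def)
    finally have 1: "distr \<pi>' ?\<nu> fst = ?\<nu>"
      unfolding \<phi>_law[OF f] fst_\<pi>2 .
    have "distr \<pi>' ?\<nu>' snd = distr \<pi>' borel snd"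
      by (intro distr_cong) auto
    also have "\<dots> = distr R borel (\<lambda>x. F (\<phi> snd x))"
      unfolding \<pi>'_def by (subst distr_distr[OF s G]) (simp add: comp_def G_def)
    also have "\<dots> = distr (distr R ((borel \<Otimes>\<^sub>M borel) \<Otimes>\<^sub>M \<rho>) (\<phi> snd)) borel F"
      by (subst distr_distr[OF F \<phi>_meas[OF s]]) (simp add: comp_def)
    finally have 2: "distr \<pi>' ?\<nu>' snd = ?\<nu>'"
      unfolding \<phi>_law[OF s] snd_\<pi>2 .
    have 3: "sets \<pi>' = sets (?\<nu> \<Otimes>\<^sub>M ?\<nu>')"
      unfolding \<pi>'_def sets_distr by (intro sets_pair_measure_cong) auto
    show ?thesis
      using 1 2 3 by (simp add: couplings_def)
  qed
  moreover have "(\<integral>\<^sup>+z. ennreal ((dist (fst z) (snd z))\<^sup>2) \<partial>\<pi>')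
        \<le> ennreal K * (\<integral>\<^sup>+z. ennreal ((dist (fst z) (snd z))\<^sup>2) \<partial>\<pi>)"
  proof -
    \<comment> \<open>Under \<open>R\<close> each input has exactly the law for which
      \<open>good\<close> is assumed to hold almost surely, so both inputs are good simultaneously
      almost everywhere.\<close>
    have g1: "AE x in R. good (\<phi> fst x)"
      by (rule AE_distrD[OF \<phi>_meas[OF f]]) (unfold \<phi>_law[OF f] fst_\<pi>2, rule good(1))
    have g2: "AE x in R. good (\<phi> snd x)"
      by (rule AE_distrD[OF \<phi>_meas[OF s]]) (unfold \<phi>_law[OF s] snd_\<pi>2, rule good(2))
    have "(\<integral>\<^sup>+z. ennreal ((dist (fst z) (snd z))\<^sup>2) \<partial>\<pi>')
        = (\<integral>\<^sup>+x. ennreal ((dist (F (\<phi> fst x)) (F (\<phi> snd x)))\<^sup>2) \<partial>R)"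
      unfolding \<pi>'_def
      by (subst nn_integral_distr[OF G borel_measurable_dist_square]) (simp_all add: G_def)
    also have "\<dots> \<le> (\<integral>\<^sup>+x. ennreal (K * (dist (fst (snd (fst x))) (snd (snd (fst x))))\<^sup>2) \<partial>R)"
      by (intro nn_integral_mono_AE, use g1 g2 in eventually_elim)
        (auto simp: \<phi>_def intro!: ennreal_leI contr)
    also have "\<dots> = (\<integral>\<^sup>+x. ennreal K * ennreal ((dist (fst (snd (fst x))) (snd (snd (fst x))))\<^sup>2) \<partial>R)"
      using K by (simp add: ennreal_mult)
    also have "\<dots> = (\<integral>\<^sup>+y. ennreal K * ennreal ((dist (fst y) (snd y))\<^sup>2) \<partial>distr R \<pi>2 (\<lambda>x. snd (fst x)))"
      by (subst nn_integral_distr)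
        (auto simp: R_def s2 intro!: borel_measurable_times_ennreal borel_measurable_dist_square)
    also have "distr R \<pi>2 (\<lambda>x. snd (fst x)) = distr (distr R (\<mu>1 \<Otimes>\<^sub>M \<pi>2) fst) \<pi>2 snd"
      unfolding R_def by (subst distr_distr) (auto simp: comp_def)
    also have "\<dots> = \<pi>2"
      unfolding R_def \<rho>.distr_pair_fst
      by (rule distr_pair_snd) unfold_locales
    also have "(\<integral>\<^sup>+y. ennreal K * ennreal ((dist (fst y) (snd y))\<^sup>2) \<partial>\<pi>2)
        = (\<integral>\<^sup>+z. ennreal K * ennreal ((dist (snd (fst z)) (snd (snd z)))\<^sup>2) \<partial>\<pi>)"
      unfolding \<pi>2_def
      by (subst nn_integral_distr[OF p]) (auto intro!: borel_measurable_times_ennreal borel_measurable_dist_square)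
    \<comment> \<open>Forgetting the velocities can only lower the cost, so the induced coupling of
      the positions costs no more than \<pi>.\<close>
    also have "\<dots> \<le> (\<integral>\<^sup>+z. ennreal K * ennreal ((dist (fst z) (snd z))\<^sup>2) \<partial>\<pi>)"
      by (intro nn_integral_mono mult_left_mono ennreal_leI power_mono dist_snd_le) auto
    also have "\<dots> = ennreal K * (\<integral>\<^sup>+z. ennreal ((dist (fst z) (snd z))\<^sup>2) \<partial>\<pi>)"
      by (rule nn_integral_cmult[OF borel_measurable_dist_square]) (simp add: sets_\<pi> flip: borel_prod)
    finally show ?thesis .
  qed
  ultimately show ?thesis
    by blast
qed

section \<open>From the scheme to the diffusion\<close>

lemma langevin_flow_contraction:
  fixes g :: "'a::real_inner \<Rightarrow> 'a" and m M v \<gamma> t :: real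
  assumes mM: "m \<le> M" and v: "2 * v < \<gamma>"
    and g: "\<And>x y. norm (g x - g y - ((m + M) / 2) *\<^sub>R (x - y)) \<le> (M - m) / 2 * norm (x - y)"
    and t: "t > 0"
    and conv: "convergent (\<lambda>n. langevin_euler t \<gamma> g n ((u, l), d))"
      "convergent (\<lambda>n. langevin_euler t \<gamma> g n ((u, l'), d))"
  shows "(dist (lim (\<lambda>n. langevin_euler t \<gamma> g n ((u, l), d))) (lim (\<lambda>n. langevin_euler t \<gamma> g n ((u, l'), d))))\<^sup>2
    \<le> (sqrt (2 * ((\<gamma> - v)\<^sup>2 + v\<^sup>2)) / (\<gamma> - 2 * v)
        * exp (max (v\<^sup>2 - m) (M - (\<gamma> - v)\<^sup>2) / (\<gamma> - 2 * v) * t))\<^sup>2 * (dist l l')\<^sup>2"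
proof -
  let ?A = "2 * ((\<gamma> - v)\<^sup>2 + v\<^sup>2) / (\<gamma> - 2 * v)\<^sup>2"
    and ?r = "max (v\<^sup>2 - m) (M - (\<gamma> - v)\<^sup>2) / (\<gamma> - 2 * v)"
  let ?E = "\<lambda>l n. langevin_euler t \<gamma> g n ((u, l), d)"
  obtain C where C: "\<And>h \<xi> u l l' k. 0 \<le> h \<Longrightarrow>
      (norm (snd (euler_scheme (langevin_drift \<gamma> g) h \<xi> (u, l) k)
           - snd (euler_scheme (langevin_drift \<gamma> g) h \<xi> (u, l') k)))\<^sup>2
      \<le> ?A * exp (real k * (2 * h * ?r + C * h\<^sup>2)) * (norm (l - l'))\<^sup>2"
    using langevin_euler_contraction[OF mM v g] by blast
  have step: "(norm (?E l n - ?E l' n))\<^sup>2 \<le> ?A * exp (2 * t * ?r + C * t\<^sup>2 / 2 ^ n) * (norm (l - l'))\<^sup>2" for n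
  proof -
    \<comment> \<open>Over 2^n steps of length t/2^n the quadratic errors add up to C t^2 / 2^n,
      which disappears in the limit and leaves the exact rate.\<close>
    have e: "real (2 ^ n) * (2 * (t / 2 ^ n) * ?r + C * (t / 2 ^ n)\<^sup>2) = 2 * t * ?r + C * t\<^sup>2 / 2 ^ n"
      by (simp add: distrib_left power2_eq_square)
    have "0 \<le> t / 2 ^ n"
      using t by simp
    from C[OF this, of "\<lambda>k. (sqrt (2 * \<gamma>) *\<^sub>R d (n, k), 0)" u l "2 ^ n" l']
    show ?thesis
      unfolding e langevin_euler_def fst_conv snd_conv .
  qed
  have "(\<lambda>n. ?A * exp (2 * t * ?r + C * t\<^sup>2 / 2 ^ n) * (norm (l - l'))\<^sup>2)
      \<longlonglongrightarrow> ?A * exp (2 * t * ?r + 0) * (norm (l - l'))\<^sup>2"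
    by (intro tendsto_intros) real_asymp
  moreover have "(\<lambda>n. (norm (?E l n - ?E l' n))\<^sup>2) \<longlonglongrightarrow> (norm (lim (?E l) - lim (?E l')))\<^sup>2"
    using conv by (intro tendsto_intros) (simp_all add: convergent_LIMSEQ_iff)
  ultimately have "(norm (lim (?E l) - lim (?E l')))\<^sup>2 \<le> ?A * exp (2 * t * ?r + 0) * (norm (l - l'))\<^sup>2"
    using step by (intro LIMSEQ_le) auto
  also have "?A * exp (2 * t * ?r + 0) = (sqrt (2 * ((\<gamma> - v)\<^sup>2 + v\<^sup>2)) / (\<gamma> - 2 * v) * exp (?r * t))\<^sup>2"
  proof -
    have "exp (2 * t * ?r + 0) = (exp (?r * t))\<^sup>2"
      by (simp add: power2_eq_square flip: exp_add)
    then show ?thesis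
      unfolding power_mult_distrib power_divide by simp
  qed
  finally show ?thesis
    by (simp only: dist_norm)
qed

theorem theorem1:
  fixes f :: "real^'p \<Rightarrow> real"
    and m M \<gamma> t :: real
    and \<mu>1 \<mu>2 \<mu>2' :: "(real^'p) measure"
    and \<Omega> :: "'w measure" and W V L :: "real \<Rightarrow> 'w \<Rightarrow> real^'p"
    and \<Omega>' :: "'w' measure" and W' V' L' :: "real \<Rightarrow> 'w' \<Rightarrow> real^'p"
  assumes "0 < m" and "m \<le> M"
    and "\<And>x. f differentiable (at x)"
    and "\<And>x. grad f differentiable (at x)"
    and "\<And>x. loewner_le (mat m) (hessian f x)"
    and "\<And>x. loewner_le (hessian f x) (mat M)"
    and "\<mu>1 \<in> space (prob_algebra borel)"
    and "\<mu>2 \<in> space (prob_algebra borel)"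
    and "\<mu>2' \<in> space (prob_algebra borel)"
    and "0 < \<gamma>" and "0 < t"
    and "kinetic_langevin \<gamma> f (\<mu>1 \<Otimes>\<^sub>M \<mu>2) \<Omega> W V L"
    and "kinetic_langevin \<gamma> f (\<mu>1 \<Otimes>\<^sub>M \<mu>2') \<Omega>' W' V' L'"
  shows "(\<exists>\<alpha> \<beta>. 0 \<le> \<alpha> \<and> \<alpha> \<le> sqrt 2 \<and> \<beta> \<ge> min m (\<gamma>\<^sup>2 - M) / \<gamma> \<and>
            W2 (distr \<Omega> borel (L t)) (distr \<Omega>' borel (L' t))
              \<le> ennreal (\<alpha> * exp (- \<beta> * t)) * W2 (\<mu>1 \<Otimes>\<^sub>M \<mu>2) (\<mu>1 \<Otimes>\<^sub>M \<mu>2'))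
       \<and> (\<forall>v. 0 \<le> v \<and> v < \<gamma> / 2 \<longrightarrow>
            W2 (distr \<Omega> borel (L t)) (distr \<Omega>' borel (L' t))
              \<le> ennreal (sqrt (2 * ((\<gamma> - v)\<^sup>2 + v\<^sup>2)) / (\<gamma> - 2 * v)
                          * exp (max (v\<^sup>2 - m) (M - (\<gamma> - v)\<^sup>2) / (\<gamma> - 2 * v) * t))
                * W2 (\<mu>1 \<Otimes>\<^sub>M \<mu>2) (\<mu>1 \<Otimes>\<^sub>M \<mu>2'))"
proof -
  note mM = \<open>m \<le> M\<close> and \<gamma> = \<open>0 < \<gamma>\<close> and t = \<open>0 < t\<close> and kl = assms(12) and kl' = assms(13)
  have \<mu>: "sets \<mu>1 = sets borel" "sets \<mu>2 = sets borel" "sets \<mu>2' = sets borel"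
    "prob_space \<mu>1" "prob_space \<mu>2" "prob_space \<mu>2'"
    using assms(7-9) by (simp_all add: space_prob_algebra)
  have mid: "norm (grad f x - grad f y - ((m + M) / 2) *\<^sub>R (x - y)) \<le> (M - m) / 2 * norm (x - y)" for x y
    by (rule grad_diff_near_midpoint[OF assms(4-6)])
  have M: "M \<ge> 0"
    using \<open>0 < m\<close> mM by simp
  have lip: "norm (grad f x - grad f y) \<le> M * norm (x - y)" for x y
  proof -
    \<comment> \<open>The Lipschitz constant M is the midpoint (m + M)/2 plus the radius (M -
      m)/2.\<close>
    have "norm (grad f x - grad f y) \<le> norm (((m + M) / 2) *\<^sub>R (x - y)) + (M - m) / 2 * norm (x - y)"
      using mid norm_triangle_sub order_trans add_left_mono by meson
    also have "norm (((m + M) / 2) *\<^sub>R (x - y)) = (m + M) / 2 * norm (x - y)"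
      using M \<open>0 < m\<close> by simp
    finally show ?thesis
      by (simp add: field_simps)
  qed
  let ?P = "\<Pi>\<^sub>M i\<in>(UNIV :: (nat \<times> nat) set). (borel :: (real^'p) measure)"
  define \<rho> where "\<rho> = distr \<Omega> ?P (\<lambda>\<omega>. dyadic_increments t (\<lambda>s. W s \<omega>))"
  define F where "F x = lim (\<lambda>n. langevin_euler t \<gamma> (grad f) n x)" for x
  have W: "brownian_motion \<Omega> W" and W': "brownian_motion \<Omega>' W'"
    by (rule kl[unfolded kinetic_langevin_def, THEN conjunct1],
        rule kl'[unfolded kinetic_langevin_def, THEN conjunct1])
  \<comment> \<open>From here on a single noise law serves both solutions, which is what allows them
    to share their noise in the coupling.\<close>
  have \<rho>': "\<rho> = distr \<Omega>' ?P (\<lambda>\<omega>. dyadic_increments t (\<lambda>s. W' s \<omega>))"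
    unfolding \<rho>_def by (rule brownian_dyadic_law_unique[OF W W' t])
  have law: "distr ((\<mu>1 \<Otimes>\<^sub>M \<mu>2) \<Otimes>\<^sub>M \<rho>) borel F = distr \<Omega> borel (L t)"
    and good: "AE x in (\<mu>1 \<Otimes>\<^sub>M \<mu>2) \<Otimes>\<^sub>M \<rho>. convergent (\<lambda>n. langevin_euler t \<gamma> (grad f) n x)"
    unfolding \<rho>_def F_def by (rule kinetic_langevin_law[OF kl \<gamma> t M lip])+
  have law': "distr ((\<mu>1 \<Otimes>\<^sub>M \<mu>2') \<Otimes>\<^sub>M \<rho>) borel F = distr \<Omega>' borel (L' t)"
    and good': "AE x in (\<mu>1 \<Otimes>\<^sub>M \<mu>2') \<Otimes>\<^sub>M \<rho>. convergent (\<lambda>n. langevin_euler t \<gamma> (grad f) n x)"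
    unfolding \<rho>' F_def by (rule kinetic_langevin_law[OF kl' \<gamma> t M lip])+
  have "(\<lambda>\<omega>. dyadic_increments t (\<lambda>s. W s \<omega>)) \<in> measurable \<Omega> ?P"
    using t W[unfolded brownian_motion_def, THEN conjunct2, THEN conjunct1]
    by (intro measurable_dyadic_increments) auto
  then have \<rho>: "prob_space \<rho>"
    unfolding \<rho>_def by (rule prob_space.prob_space_distr[OF W[unfolded brownian_motion_def, THEN conjunct1]])
  have "continuous_on UNIV (grad f)"
    using M lip by (intro lipschitz_on_continuous_on[of M] lipschitz_onI) (auto simp: dist_norm)
  then have "F \<in> borel_measurable (borel \<Otimes>\<^sub>M ?P)"
    unfolding F_def by (intro borel_measurable_lim_metric borel_measurable_langevin_euler)
  moreover have "sets (borel \<Otimes>\<^sub>M ?P) =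
      sets (((borel :: (real^'p) measure) \<Otimes>\<^sub>M (borel :: (real^'p) measure)) \<Otimes>\<^sub>M \<rho>)"
    unfolding \<rho>_def borel_prod by (intro sets_pair_measure_cong) simp_all
  ultimately have F: "F \<in> borel_measurable ((borel \<Otimes>\<^sub>M borel) \<Otimes>\<^sub>M \<rho>)"
    using measurable_cong_sets by blast
  have main: "W2 (distr \<Omega> borel (L t)) (distr \<Omega>' borel (L' t))
      \<le> ennreal (sqrt (2 * ((\<gamma> - v)\<^sup>2 + v\<^sup>2)) / (\<gamma> - 2 * v)
                  * exp (max (v\<^sup>2 - m) (M - (\<gamma> - v)\<^sup>2) / (\<gamma> - 2 * v) * t))
        * W2 (\<mu>1 \<Otimes>\<^sub>M \<mu>2) (\<mu>1 \<Otimes>\<^sub>M \<mu>2')" (is "_ \<le> ennreal ?c * _") if "0 \<le> v" "v < \<gamma> / 2" for v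
  proof (rule W2_le_by_couplings)
    have v: "2 * v < \<gamma>" "\<gamma> - v > 0"
      using that by auto
    then show "?c > 0"
      by (simp add: add_pos_nonneg)
    fix \<pi> assume \<pi>: "\<pi> \<in> couplings (\<mu>1 \<Otimes>\<^sub>M \<mu>2) (\<mu>1 \<Otimes>\<^sub>M \<mu>2')"
    show "\<exists>\<pi>'\<in>couplings (distr \<Omega> borel (L t)) (distr \<Omega>' borel (L' t)).
      (\<integral>\<^sup>+z. ennreal ((dist (fst z) (snd z))\<^sup>2) \<partial>\<pi>')
        \<le> ennreal (?c\<^sup>2) * (\<integral>\<^sup>+z. ennreal ((dist (fst z) (snd z))\<^sup>2) \<partial>\<pi>)"
      unfolding law[symmetric] law'[symmetric]
      by (rule shared_noise_coupling[OF \<mu> \<rho> F \<pi> good good'])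
        (unfold F_def, rule langevin_flow_contraction[OF mM v(1) mid t], assumption+, simp)
  qed
  have "\<exists>\<alpha> \<beta>. 0 \<le> \<alpha> \<and> \<alpha> \<le> sqrt 2 \<and> \<beta> \<ge> min m (\<gamma>\<^sup>2 - M) / \<gamma> \<and>
            W2 (distr \<Omega> borel (L t)) (distr \<Omega>' borel (L' t))
              \<le> ennreal (\<alpha> * exp (- \<beta> * t)) * W2 (\<mu>1 \<Otimes>\<^sub>M \<mu>2) (\<mu>1 \<Otimes>\<^sub>M \<mu>2')"
  \<comment> \<open>Both witnesses come from v = 0: the prefactor becomes \<alpha> = sqrt 2, and max
    (-m) (M - \<gamma>^2) = - min m (\<gamma>^2 - M) makes \<beta> equal to its lower bound.\<close>
  proof (intro exI conjI)
    have "sqrt (2 * ((\<gamma> - 0)\<^sup>2 + 0\<^sup>2)) / (\<gamma> - 2 * 0) = sqrt 2"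
      using \<gamma> by (simp add: real_sqrt_mult)
    moreover have "max (0\<^sup>2 - m) (M - (\<gamma> - 0)\<^sup>2) / (\<gamma> - 2 * 0) = - (min m (\<gamma>\<^sup>2 - M) / \<gamma>)"
    proof -
      have "max (- m) (M - \<gamma>\<^sup>2) = - min m (\<gamma>\<^sup>2 - M)"
        by (auto simp: max_def min_def)
      then show ?thesis
        by simp
    qed
    ultimately show "W2 (distr \<Omega> borel (L t)) (distr \<Omega>' borel (L' t))
        \<le> ennreal (sqrt 2 * exp (- (min m (\<gamma>\<^sup>2 - M) / \<gamma>) * t)) * W2 (\<mu>1 \<Otimes>\<^sub>M \<mu>2) (\<mu>1 \<Otimes>\<^sub>M \<mu>2')"
      using main[of 0] \<gamma> by (simp only:)
  qed simp_all
  then show ?thesis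
    using main by blast
qed

end
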